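(* Let $A$, $B$, $B-A$, $\mathbb{X}$ and $\mathbb{Y}$ be positive stable matrices in $\mathbb{C}^{r\times r}$ such that $A$, $B$, $\mathbb{X}$ and $\mathbb{Y}$ commute with each other. Then the new extended gamma matrix function $\Gamma_{\mathbb{Y}}^{(A,B)}(\mathbb{X})$ can also be presented in the integral form $$\Gamma_{\mathbb{Y}}^{(A,B)}(\mathbb{X})=\Gamma(B)\,\Gamma^{-1}(A)\,\Gamma^{-1}(B-A)\int_0^1 \Gamma_{\mathbb{Y}\mu^2}(\mathbb{X})\;\mu^{A-\mathbb{X}-I}\,(1-\mu)^{B-A-I}\,d\mu .$$
   Context: A matrix in $\mathbb{C}^{r\times r}$ is positive stable if all its eigenvalues have positive real part; $I$ is the identity matrix. For $t>0$ and a square matrix $M$, $t^M=\exp(M\ln t)$. For positive stable $M$, $\Gamma(M)=\int_0^\infty e^{-t}t^{M-I}\,dt$, and $\Gamma^{-1}(M)$ denotes the inverse matrix of $\Gamma(M)$. The Pochhammer symbol is $(M)_0=I$, $(M)_n=M(M+I)\cdots(M+(n-1)I)$ for $n\ge1$. For positive stable $B$ and a square matrix $W$, ${}_1F_1(A;B;W)=\sum_{n\ge0}(A)_n\,[(B)_n]^{-1}\,\frac{W^n}{n!}$. For positive stable $\mathbb{X},\mathbb{Y}$, $$\Gamma_{\mathbb{Y}}(\mathbb{X})=\int_0^\infty t^{\mathbb{X}-I}\exp(-tI-\mathbb{Y}t^{-1})\,dt .$$ For positive stable $A,B,\mathbb{X},\mathbb{Y}$ the new extended gamma matrix function is defined as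 $$\Gamma_{\mathbb{Y}}^{(A,B)}(\mathbb{X})=\int_0^\infty {}_1F_1(A;B;-tI-\mathbb{Y}t^{-1})\,t^{\mathbb{X}-I}\,dt .$$ *)

theory Defs
  imports "HOL-Analysis.Analysis"
begin

text \<open>
  Matrices in $C^{r\times r}$ are elements of \<^typ>\<open>complex^'n^'n\<close> with \<open>r = CARD('n)\<close>. The
  infinite series below are limits of partial sums in this finite-dimensional Banach space. All
  integrals are Lebesgue (Bochner) integrals of matrix-valued functions. The library's integral is
  \<open>0\<close> for a non-integrable integrand.
\<close>

definition eigenvalue :: "complex^'n^'n \<Rightarrow> complex \<Rightarrow> bool" where
  "eigenvalue M c \<longleftrightarrow> (\<exists>v. v \<noteq> 0 \<and> M *v v = c *s v)"

definition positive_stable :: "complex^'n^'n \<Rightarrow> bool" where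
  "positive_stable M \<longleftrightarrow> (\<forall>c. eigenvalue M c \<longrightarrow> Re c > 0)"

definition commuting :: "complex^'n^'n \<Rightarrow> complex^'n^'n \<Rightarrow> bool" where
  "commuting M N \<longleftrightarrow> M ** N = N ** M"

text \<open>
  The multiplication \<open>*\<close> that the library provides on \<^typ>\<open>complex^'n^'n\<close> is entrywise, so \<open>^\<close>
  on that type is not the power of a matrix, and \<^const>\<open>exp\<close> is not available there.
\<close>

primrec mat_power :: "complex^'n^'n \<Rightarrow> nat \<Rightarrow> complex^'n^'n" where
  "mat_power M 0 = mat 1"
| "mat_power M (Suc n) = mat_power M n ** M"

definition mat_exp :: "complex^'n^'n \<Rightarrow> complex^'n^'n" where
  "mat_exp M = (\<Sum>n. (1 / fact n) *\<^sub>R mat_power M n)"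

text \<open>\<open>t\<^sup>M\<close> for real \<open>t > 0\<close>.\<close>

definition mat_powr :: "real \<Rightarrow> complex^'n^'n \<Rightarrow> complex^'n^'n" where
  "mat_powr t M = mat_exp (ln t *\<^sub>R M)"

definition mat_Gamma :: "complex^'n^'n \<Rightarrow> complex^'n^'n" where
  "mat_Gamma M = (LBINT t:{0<..}. exp (- t) *\<^sub>R mat_powr t (M - mat 1))"

primrec mat_pochhammer :: "complex^'n^'n \<Rightarrow> nat \<Rightarrow> complex^'n^'n" where
  "mat_pochhammer M 0 = mat 1"
| "mat_pochhammer M (Suc n) = mat_pochhammer M n ** (M + mat (of_nat n))"

definition mat_1F1 :: "complex^'n^'n \<Rightarrow> complex^'n^'n \<Rightarrow> complex^'n^'n \<Rightarrow> complex^'n^'n" where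
  "mat_1F1 A B W =
     (\<Sum>n. mat_pochhammer A n ** matrix_inv (mat_pochhammer B n) ** ((1 / fact n) *\<^sub>R mat_power W n))"

text \<open>
  In the next two constants the first matrix argument \<open>Y\<close> is the subscript and \<open>X\<close> is the
  argument of the function. The matrix \<open>- t *\<^sub>R mat 1 - (1 / t) *\<^sub>R Y\<close> is $-tI-Yt^{-1}$.
\<close>

definition mat_Gamma_sub :: "complex^'n^'n \<Rightarrow> complex^'n^'n \<Rightarrow> complex^'n^'n" where
  "mat_Gamma_sub Y X =
     (LBINT t:{0<..}. mat_powr t (X - mat 1) ** mat_exp (- t *\<^sub>R mat 1 - (1 / t) *\<^sub>R Y))"

definition ext_Gamma_integrand ::
    "complex^'n^'n \<Rightarrow> complex^'n^'n \<Rightarrow> complex^'n^'n \<Rightarrow> complex^'n^'n \<Rightarrow> real \<Rightarrow> complex^'n^'n" where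
  "ext_Gamma_integrand A B Y X t =
     mat_1F1 A B (- t *\<^sub>R mat 1 - (1 / t) *\<^sub>R Y) ** mat_powr t (X - mat 1)"

definition ext_Gamma ::
    "complex^'n^'n \<Rightarrow> complex^'n^'n \<Rightarrow> complex^'n^'n \<Rightarrow> complex^'n^'n \<Rightarrow> complex^'n^'n" where
  "ext_Gamma A B Y X = (LBINT t:{0<..}. ext_Gamma_integrand A B Y X t)"

end

theory Submission
  imports Defs "HOL-Computational_Algebra.Fundamental_Theorem_Algebra"
begin

text \<open>
  Up to the constant $K = \Gamma(B)\Gamma^{-1}(A)\Gamma^{-1}(B-A)$, Kummer's function is the Euler
  integral of $e^{\mu W}\mu^{A-I}(1-\mu)^{B-A-I}$ over $(0,1)$, because
  $\Gamma(A+nI)\,\Gamma(B-A) = \Gamma(B+nI)\,\mathrm{B}(A+nI,B-A)$ turns the quotient of Pochhammer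
  symbols into a beta integral. Inserting this with $W = -tI-\mathbb{Y}t^{-1}$, exchanging the two
  integrations and substituting $s = t\mu$ gives the formula whenever Fubini applies, which is the
  case if $A-\mathbb{X}$ is positive stable: every factor is then bounded in norm by the corresponding
  scalar one, since $\|e^{-sM}\| \le C e^{-\alpha s}$ for positive stable $M$.

  If $A-\mathbb{X}$ is not positive stable, neither side is integrable and both integrals are the junk
  value \<open>0\<close>. Indeed, let $v$ be an eigenvector of $A-\mathbb{X}$ whose eigenvalue $c$ has real part at
  most \<open>0\<close>. Applied to $v$, the left integrand behaves like $K t^{-c-1}\,\Gamma(A)v$ as
  $t\to\infty$ and the right integrand like $\mu^{c-1}\,\Gamma(\mathbb{X})v$ as $\mu\to0$, where
  $\Gamma(A)$ and $\Gamma(\mathbb{X})$ are invertible.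
\<close>

section \<open>Matrices as a Banach algebra\<close>

text \<open>The substitution s = t\<mu> explains the shape of the right side: exp(-(\<mu>/t)Y)
  becomes exp(-(\<mu>^2/s)Y), and t^(X-I) dt = s^(X-I) \<mu>^(-X) ds turns \<mu>^(A-I) into
  \<mu>^(A-X-I). So a condition on A-X enters, although the hypotheses say nothing about its
  eigenvalues. If the double integral does not converge absolutely, the two single integrals might
  still converge, because the inner integration can cancel; this is why the asymptotics of both
  inner integrals are computed. The matrices need not be diagonalisable. Upper bounds rest on
  exponential decay, which is obtained without the Jordan form; lower bounds and the invertibility
  of Gamma(M) are read off on a single eigenvector.\<close>

text \<open>
  The copy \<open>cmat\<close> of the matrix type carries the matrix product as \<open>*\<close> and the operator norm, so that
  the library's \<^const>\<open>exp\<close> applies to it.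
\<close>

typedef ('n::finite) cmat = "UNIV :: (complex^'n^'n) set"
  morphisms mat_of cmat by simp

setup_lifting type_definition_cmat

lemma mat_of_cmat [simp]: "mat_of (cmat M) = M"
  by (simp add: cmat_inverse)

lemma cmat_mat_of [simp]: "cmat (mat_of M) = M"
  by (simp add: mat_of_inverse)

lemma scaleR_matrix_mult_left: "(r *\<^sub>R (A::complex^'n^'n)) ** B = r *\<^sub>R (A ** B)"
  by (simp add: matrix_matrix_mult_def vec_eq_iff scaleR_right.sum)

lemma scaleR_matrix_mult_right: "(A::complex^'n^'n) ** (r *\<^sub>R B) = r *\<^sub>R (A ** B)"
  by (simp add: matrix_matrix_mult_def vec_eq_iff scaleR_right.sum)

lemma scaleR_matrix_vector_mult: "(r *\<^sub>R (A::complex^'n^'n)) *v v = r *\<^sub>R (A *v v)"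
  by (simp add: matrix_vector_mult_def vec_eq_iff scaleR_right.sum)

text \<open>An entry is a coordinate of the image of the basis vector \<open>axis j 1\<close>. The
  bound makes the operator norm definite and lets it control the Euclidean norm of the
  entries.\<close>

lemma onorm_entry_bound: "norm (M $ i $ j) \<le> onorm ((*v) (M::complex^'n^'n))"
proof -
  have "M $ i $ j = (M *v axis j 1) $ i"
    by (simp add: matrix_vector_mult_def axis_def if_distrib cong: if_cong)
  also have "norm \<dots> \<le> norm (M *v axis j 1)"
    by (rule Finite_Cartesian_Product.norm_nth_le)
  also have "\<dots> \<le> onorm ((*v) M) * norm (axis j (1::complex))"
    by (rule onorm) simp
  finally show ?thesis by (simp add: norm_axis_1)
qed

instantiation cmat :: (finite) real_normed_algebra_1
begin

lift_definition zero_cmat :: "'a cmat" is 0 .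
lift_definition one_cmat :: "'a cmat" is "mat 1" .
lift_definition plus_cmat :: "'a cmat \<Rightarrow> 'a cmat \<Rightarrow> 'a cmat" is "(+)" .
lift_definition minus_cmat :: "'a cmat \<Rightarrow> 'a cmat \<Rightarrow> 'a cmat" is "(-)" .
lift_definition uminus_cmat :: "'a cmat \<Rightarrow> 'a cmat" is "uminus" .
lift_definition times_cmat :: "'a cmat \<Rightarrow> 'a cmat \<Rightarrow> 'a cmat" is "(**)" .
lift_definition scaleR_cmat :: "real \<Rightarrow> 'a cmat \<Rightarrow> 'a cmat" is "(*\<^sub>R)" .
text \<open>The class requires the unit to have norm 1; the Euclidean norm of the entries would give
  it the norm sqrt r.\<close>

lift_definition norm_cmat :: "'a cmat \<Rightarrow> real" is "\<lambda>M. onorm ((*v) M)" .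

definition dist_cmat :: "'a cmat \<Rightarrow> 'a cmat \<Rightarrow> real" where
  "dist_cmat a b = norm (a - b)"
definition sgn_cmat :: "'a cmat \<Rightarrow> 'a cmat" where
  "sgn_cmat x = scaleR (inverse (norm x)) x"
definition uniformity_cmat :: "('a cmat \<times> 'a cmat) filter" where
  "uniformity_cmat = (INF e\<in>{0<..}. principal {(x, y). dist x y < e})"
definition open_cmat :: "'a cmat set \<Rightarrow> bool" where
  "open_cmat S \<longleftrightarrow> (\<forall>x\<in>S. \<forall>\<^sub>F (x', y) in uniformity. x' = x \<longrightarrow> y \<in> S)"

instance
proof
  fix a b c x y z :: "'a cmat" and r s :: real and U :: "'a cmat set"
  have bl: "bounded_linear ((*v) M)" for M :: "complex^'a^'a" by simp
  show "a + b + c = a + (b + c)" by transfer simp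
  show "a + b = b + a" by transfer simp
  show "0 + a = a" by transfer simp
  show "- a + a = 0" by transfer simp
  show "a - b = a + - b" by transfer simp
  show "r *\<^sub>R (x + y) = r *\<^sub>R x + r *\<^sub>R y" by transfer (simp add: scaleR_right_distrib)
  show "(r + s) *\<^sub>R x = r *\<^sub>R x + s *\<^sub>R x" by transfer (simp add: scaleR_left_distrib)
  show "r *\<^sub>R s *\<^sub>R x = (r * s) *\<^sub>R x" by transfer simp
  show "1 *\<^sub>R x = x" by transfer simp
  show "a * b * c = a * (b * c)" by transfer (simp add: matrix_mul_assoc)
  show "(a + b) * c = a * c + b * c" by transfer (simp add: matrix_matrix_mult_def vec_eq_iff distrib_right sum.distrib)
  show "a * (b + c) = a * b + a * c" by transfer (simp add: matrix_add_ldistrib)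
  show "r *\<^sub>R x * y = r *\<^sub>R (x * y)" by transfer (simp add: scaleR_matrix_mult_left)
  show "x * r *\<^sub>R y = r *\<^sub>R (x * y)" by transfer (simp add: scaleR_matrix_mult_right)
  show "1 * a = a" by transfer simp
  show "a * 1 = a" by transfer simp
  show "(0::'a cmat) \<noteq> 1"
    by transfer (simp add: vec_eq_iff mat_def)
  show "dist x y = norm (x - y)" by (rule dist_cmat_def)
  show "sgn x = scaleR (inverse (norm x)) x" by (rule sgn_cmat_def)
  show "uniformity = (INF e\<in>{0<..}. principal {(x::'a cmat, y). dist x y < e})"
    by (rule uniformity_cmat_def)
  show "open U \<longleftrightarrow> (\<forall>x\<in>U. \<forall>\<^sub>F (x', y) in uniformity. x' = x \<longrightarrow> y \<in> U)"
    by (rule open_cmat_def)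
  show "norm x = 0 \<longleftrightarrow> x = 0"
  proof transfer
    fix M :: "complex^'a^'a"
    show "onorm ((*v) M) = 0 \<longleftrightarrow> M = 0"
    proof
      assume 0: "onorm ((*v) M) = 0"
      show "M = 0" using onorm_entry_bound[of M] unfolding 0 by (simp add: vec_eq_iff)
    next
      assume "M = 0"
      then have "(*v) M = (\<lambda>_. 0)" by auto
      then show "onorm ((*v) M) = 0" by (simp add: onorm_zero)
    qed
  qed
  show "norm (x + y) \<le> norm x + norm y"
  proof transfer
    fix M N :: "complex^'a^'a"
    show "onorm ((*v) (M + N)) \<le> onorm ((*v) M) + onorm ((*v) N)"
      using onorm_triangle[OF bl bl, of M N]
      by (simp add: matrix_vector_mult_add_rdistrib[abs_def])
  qed
  show "norm (r *\<^sub>R x) = \<bar>r\<bar> * norm x"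
    by transfer (simp add: scaleR_matrix_vector_mult[abs_def] onorm_scaleR)
  show "norm (x * y) \<le> norm x * norm y"
  proof transfer
    fix M N :: "complex^'a^'a"
    have "(*v) (M ** N) = (*v) M \<circ> (*v) N" by (auto simp: matrix_vector_mul_assoc)
    then show "onorm ((*v) (M ** N)) \<le> onorm ((*v) M) * onorm ((*v) N)"
      using onorm_compose[OF bl bl, of M N] by simp
  qed
  show "norm (1 :: 'a cmat) = 1"
  proof transfer
    have "(*v) (mat 1) = (\<lambda>v :: complex^'a. v)" by auto
    then show "onorm ((*v) (mat 1 :: complex^'a^'a)) = 1" by (simp add: onorm_id)
  qed
qed

end

lemma mat_of_simps [simp]:
  "mat_of 0 = 0" "mat_of 1 = mat 1" "mat_of (x + y) = mat_of x + mat_of y"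
  "mat_of (x - y) = mat_of x - mat_of y" "mat_of (- x) = - mat_of x"
  "mat_of (x * y) = mat_of x ** mat_of y" "mat_of (r *\<^sub>R x) = r *\<^sub>R mat_of x"
  by (transfer; simp)+

lemma cmat_simps:
  "cmat 0 = 0" "cmat (mat 1) = 1" "cmat (x + y) = cmat x + cmat y"
  "cmat (x - y) = cmat x - cmat y" "cmat (- x) = - cmat x"
  "cmat (x ** y) = cmat x * cmat y" "cmat (r *\<^sub>R x) = r *\<^sub>R cmat x"
  by (simp_all flip: mat_of_inject)

lemma norm_mat_of_mult_le: "norm (mat_of x *v v) \<le> norm x * norm v"
  by transfer (rule onorm, simp)

text \<open>Together with \<open>bounded_linear_cmat\<close> this makes the two norms equivalent, so
  limits, series and integrals pass between the copy and the matrices. The factor r^2 merely counts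
  entries.\<close>

lemma bounded_linear_mat_of: "bounded_linear mat_of"
proof (rule bounded_linear_intro)
  fix x :: "'a cmat"
  have "norm (mat_of x) \<le> (\<Sum>i\<in>UNIV. norm (mat_of x $ i))" by (simp add: norm_vec_def L2_set_le_sum)
  also have "\<dots> \<le> (\<Sum>i\<in>UNIV. \<Sum>j\<in>UNIV. norm (mat_of x $ i $ j))"
    by (intro sum_mono) (simp add: norm_vec_def L2_set_le_sum)
  also have "\<dots> \<le> (\<Sum>i\<in>(UNIV::'a set). \<Sum>j\<in>(UNIV::'a set). norm x)"
    by (intro sum_mono) (transfer, rule onorm_entry_bound)
  finally show "norm (mat_of x) \<le> norm x * (real CARD('a) * real CARD('a))"
    by (simp add: mult_ac)
qed simp_all

lemma bounded_linear_cmat: "bounded_linear cmat"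
proof (rule bounded_linear_intro)
  fix M :: "complex^'a^'a"
  have "norm (cmat M) = onorm ((*v) M)" by transfer simp
  also have "\<dots> \<le> norm M * (real CARD('a) * real CARD('a))"
  proof (rule onorm_bound)
    fix v :: "complex^'a"
    have entry: "norm (M $ i $ j) \<le> norm M" for i j
      by (rule order_trans[OF Finite_Cartesian_Product.norm_nth_le Finite_Cartesian_Product.norm_nth_le])
    have "norm (M *v v) \<le> (\<Sum>i\<in>UNIV. norm ((M *v v) $ i))"
      by (simp add: norm_vec_def L2_set_le_sum)
    also have "\<dots> \<le> (\<Sum>i\<in>(UNIV::'a set). \<Sum>j\<in>(UNIV::'a set). norm M * norm v)"
    proof (rule sum_mono)
      fix i
      show "norm ((M *v v) $ i) \<le> (\<Sum>j\<in>(UNIV::'a set). norm M * norm v)"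
        unfolding matrix_vector_mult_def vec_lambda_beta
        by (rule sum_norm_le)
          (auto simp: norm_mult intro!: mult_mono entry Finite_Cartesian_Product.norm_nth_le)
    qed
    finally show "norm (M *v v) \<le> norm M * (real CARD('a) * real CARD('a)) * norm v"
      by (simp add: mult_ac)
  qed simp
  finally show "norm (cmat M) \<le> norm M * (real CARD('a) * real CARD('a))" .
qed (simp_all add: cmat_simps)

instance cmat :: (finite) banach
proof
  fix X :: "nat \<Rightarrow> 'a cmat"
  assume "Cauchy X"
  then have "Cauchy (\<lambda>n. mat_of (X n))"
    by (rule bounded_linear.Cauchy[OF bounded_linear_mat_of])
  then obtain L where "(\<lambda>n. mat_of (X n)) \<longlonglongrightarrow> L"
    unfolding Cauchy_convergent_iff convergent_def by blast
  then have "(\<lambda>n. cmat (mat_of (X n))) \<longlonglongrightarrow> cmat L"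
    by (rule bounded_linear.tendsto[OF bounded_linear_cmat])
  then show "convergent X" by (auto simp: convergent_def)
qed

text \<open>Bochner integrals take values in second countable spaces. A countable basis of the
  matrix space is pulled back along the homeomorphism \<open>mat_of\<close>.\<close>

instance cmat :: (finite) second_countable_topology
proof
  obtain B :: "(complex^'a^'a) set set" where B: "countable B" "topological_basis B"
    using ex_countable_basis by auto
  have "topological_basis ((\<lambda>S. mat_of -` S) ` B)"
    unfolding topological_basis_def
  proof (intro conjI allI impI ballI)
    fix S assume "S \<in> (\<lambda>S. mat_of -` S) ` B"
    then show "open (S :: 'a cmat set)"
      using topological_basis_open[OF B(2)] by (auto intro!: open_vimage continuous_at_imp_continuous_on
          linear_continuous_at bounded_linear_mat_of)
  next
    fix S :: "'a cmat set" assume "open S"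
    then have "open (cmat -` S)"
      by (auto intro!: open_vimage continuous_at_imp_continuous_on
          linear_continuous_at bounded_linear_cmat)
    then obtain B' where "B' \<subseteq> B" "\<Union>B' = cmat -` S"
      using B(2) unfolding topological_basis_def by metis
    then have "S = (\<Union>T\<in>B'. mat_of -` T)"
      by (metis (no_types) Collect_mem_eq UN_I Union_iff cmat_mat_of subsetI subset_antisym vimage_Collect_eq vimage_Union vimage_eq)
    with \<open>B' \<subseteq> B\<close> show "\<exists>B'\<subseteq>(\<lambda>S. mat_of -` S) ` B. \<Union> B' = S"
      by (intro exI[of _ "(\<lambda>S. mat_of -` S) ` B'"]) auto
  qed
  then show "\<exists>B::'a cmat set set. countable B \<and> open = generate_topology B"
    using B(1) by (intro exI[of _ "(\<lambda>S. mat_of -` S) ` B"]) (auto intro: topological_basis_imp_subbasis)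
qed

lemma mat_of_power: "mat_of (x ^ n) = mat_power (mat_of x) n"
  by (induction n) (simp_all add: power_Suc2 del: power_Suc)

lemma mat_exp_eq: "mat_exp M = mat_of (exp (cmat M))"
proof -
  have "mat_of (\<Sum>n. cmat M ^ n /\<^sub>R fact n) = (\<Sum>n. mat_of (cmat M ^ n /\<^sub>R fact n))"
    by (rule bounded_linear.suminf[OF bounded_linear_mat_of]) (rule summable_exp_generic)
  then show ?thesis
    by (simp add: exp_def mat_exp_def mat_of_power divide_inverse)
qed

section \<open>Eigenvalues and exponential decay\<close>

definition shift :: "complex^'n^'n \<Rightarrow> complex \<Rightarrow> complex^'n \<Rightarrow> complex^'n" where
  "shift M c v = M *v v - c *s v"

text \<open>The vector p(M)v, evaluated by Horner's scheme.\<close>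

definition poly_act :: "complex^'n^'n \<Rightarrow> complex poly \<Rightarrow> complex^'n \<Rightarrow> complex^'n" where
  "poly_act M p v = fold_coeffs (\<lambda>a w. a *s v + M *v w) p 0"

lemma poly_act_0 [simp]: "poly_act M 0 v = 0"
  by (simp add: poly_act_def)

lemma poly_act_pCons [simp]: "poly_act M (pCons a p) v = a *s v + M *v poly_act M p v"
  by (cases "p = 0 \<and> a = 0") (auto simp: poly_act_def fold_coeffs_pCons_not_0_0_eq)

lemma matrix_vector_mult_smult: "(M::complex^'n^'n) *v (c *s v) = c *s (M *v v)"
  by (simp add: vector_scalar_commute)

lemma poly_act_add: "poly_act M (p + q) v = poly_act M p v + poly_act M q v"
  by (induction p q rule: poly_induct2)
    (simp_all add: matrix_vector_right_distrib vector_sadd_rdistrib)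

lemma poly_act_smult: "poly_act M (smult c p) v = c *s poly_act M p v"
  by (induction p)
    (simp_all add: matrix_vector_mult_smult vector_add_ldistrib vector_smult_assoc)

lemma poly_act_sum: "poly_act M (sum f I) v = (\<Sum>i\<in>I. poly_act M (f i) v)"
  by (induction I rule: infinite_finite_induct) (simp_all add: poly_act_add)

lemma poly_act_monom: "poly_act M (monom c n) v = c *s (((*v) M ^^ n) v)"
  by (induction n) (simp_all add: monom_0 monom_Suc matrix_vector_mult_smult)

lemma poly_act_linear_factor:
  "poly_act M ([:- c, 1:] * p) v = shift M c (poly_act M p v)"
proof -
  have "[:- c, 1:] * p = pCons 0 p + smult (- c) p" by (simp add: mult_pCons_left)
  then show ?thesis
    by (simp only: shift_def poly_act_add poly_act_smult poly_act_pCons) simp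
qed

lemma poly_act_shift: "poly_act M p (shift M c v) = shift M c (poly_act M p v)"
  by (induction p)
    (simp_all add: shift_def matrix_vector_mult_smult matrix_vector_right_distrib
      matrix_vector_mult_diff_distrib vector_smult_assoc vector_add_ldistrib vector_ssub_ldistrib
      mult.commute)

text \<open>The N + 1 vectors v, Mv, ..., M^N v are linearly dependent when N is the real dimension
  of the space, and a relation between them is the polynomial. Real coefficients are enough.\<close>

lemma ex_annihilating_poly:
  fixes M :: "complex^'n^'n"
  shows "\<exists>p. p \<noteq> 0 \<and> poly_act M p v = 0"
proof -
  define N where "N = DIM(complex^'n)"
  define f where "f = (\<lambda>i. ((*v) M ^^ i) v)"
  show ?thesis
  \<comment> \<open>\<open>dependent\<close> speaks of a set of vectors, in which a repetition M^i v
    = M^j v would be lost; such a repetition is itself a relation.\<close>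
  proof (cases "inj_on f {..N}")
    case False
    then obtain i j where "i \<noteq> j" "f i = f j" by (auto simp: inj_on_def)
    moreover have "monom 1 i + monom (-1) j \<noteq> (0 :: complex poly)"
    proof
      assume "monom 1 i + monom (-1) j = (0 :: complex poly)"
      then have "coeff (monom 1 i + monom (-1) j) i = (0 :: complex)" by simp
      with \<open>i \<noteq> j\<close> show False by (simp add: if_split_asm)
    qed
    ultimately show ?thesis
      by (intro exI[of _ "monom 1 i + monom (-1) j"]) (simp add: poly_act_add poly_act_monom f_def)
  next
    case True
    then have "card (f ` {..N}) > DIM(complex^'n)"
      by (simp add: card_image N_def)
    then have "dependent (f ` {..N})" by (intro dependent_biggerset) auto
    then obtain u w where u: "w \<in> f ` {..N}" "u w \<noteq> 0" "(\<Sum>w\<in>f ` {..N}. u w *\<^sub>R w) = 0"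
      by (subst (asm) real_vector.dependent_finite) auto
    define p where "p = (\<Sum>i\<le>N. monom (complex_of_real (u (f i))) i)"
    have "poly_act M p v = (\<Sum>i\<le>N. u (f i) *\<^sub>R f i)"
      by (auto simp: p_def poly_act_sum poly_act_monom f_def vec_eq_iff scaleR_complex.code complex_eq_iff)
    also have "\<dots> = 0" using u(3) True by (simp add: sum.reindex)
    finally have "poly_act M p v = 0" .
    moreover obtain i where i: "w = f i" "i \<le> N" using u(1) by auto
    then have "coeff p i \<noteq> 0" using u(2) by (simp add: p_def coeff_sum)
    then have "p \<noteq> 0" by auto
    ultimately show ?thesis by blast
  qed
qed

text \<open>A root c splits the factor M - c off p(M). Moved onto the vector, it leaves a polynomial
  of smaller degree that annihilates (M - c)v.\<close>

lemma ex_annihilating_shifts: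
  fixes M :: "complex^'n^'n"
  shows "\<exists>cs. foldr (shift M) cs v = 0"
proof -
  have "\<exists>cs. foldr (shift M) cs v = 0" if "p \<noteq> 0" "poly_act M p v = 0" for p v
    using that
  proof (induction "degree p" arbitrary: p v)
    case 0
    then obtain c where "p = [:c:]" by (metis degree_eq_zeroE)
    with 0 have "v = 0" by (auto simp: vec_eq_iff)
    then show ?case by (intro exI[of _ "[]"]) simp
  next
    case (Suc n)
    then have "\<not> constant (poly p)" by (simp add: constant_degree)
    then obtain c where "poly p c = 0" using fundamental_theorem_of_algebra by blast
    then obtain q where q: "p = [:- c, 1:] * q" by (metis dvdE poly_eq_0_iff_dvd)
    with Suc.prems have "q \<noteq> 0" by auto
    then have "degree p = Suc (degree q)" unfolding q by (subst degree_mult_eq) auto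
    with Suc.hyps(2) have "n = degree q" by simp
    moreover have "poly_act M q (shift M c v) = 0"
      using Suc.prems(2) unfolding q by (simp only: poly_act_shift poly_act_linear_factor)
    ultimately obtain cs where "foldr (shift M) cs (shift M c v) = 0"
      using Suc.hyps(1)[of q] \<open>q \<noteq> 0\<close> by blast
    \<comment> \<open>\<open>foldr\<close> applies the last entry of the list first, so the new root
      goes to the end.\<close>
    then show ?case by (intro exI[of _ "cs @ [c]"]) simp
  qed
  then show ?thesis using ex_annihilating_poly[of M v] by blast
qed

lemma shift_commute: "shift M c (shift M d v) = shift M d (shift M c v)"
  by (simp add: shift_def matrix_vector_mult_smult matrix_vector_mult_diff_distrib
      vector_ssub_ldistrib vector_smult_assoc algebra_simps)

lemma foldr_shift_commute: "foldr (shift M) cs (shift M c v) = shift M c (foldr (shift M) cs v)"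
  by (induction cs) (simp_all add: shift_commute)

text \<open>Apply the shifts of an annihilating list one after the other: the vector just before the
  first zero lies in V and is an eigenvector.\<close>

lemma ex_eigenvector_in_invariant:
  fixes M :: "complex^'n^'n"
  assumes inv: "\<And>w c. w \<in> V \<Longrightarrow> shift M c w \<in> V" and v: "v \<in> V" "v \<noteq> 0"
  shows "\<exists>c w. w \<in> V \<and> w \<noteq> 0 \<and> M *v w = c *s w"
proof -
  obtain cs where "foldr (shift M) cs v = 0" using ex_annihilating_shifts by blast
  then have "\<exists>w\<in>V. w \<noteq> 0 \<and> (\<exists>c. shift M c w = 0)"
  proof (induction cs)
    case Nil
    then show ?case using v by simp
  next
    case (Cons c cs)
    have "foldr (shift M) cs v \<in> V" using v(1) by (induction cs) (auto intro: inv)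
    with Cons show ?case by (cases "foldr (shift M) cs v = 0") auto
  qed
  then show ?thesis by (auto simp: shift_def)
qed

text \<open>In a shortest annihilating list every c is an eigenvalue: the shifts commute, so the one
  by c can be applied last, and the vector it kills is nonzero by minimality.\<close>

lemma ex_annihilating_eigenvalues:
  fixes M :: "complex^'n^'n"
  obtains cs where "foldr (shift M) cs v = 0" "\<And>c. c \<in> set cs \<Longrightarrow> eigenvalue M c"
proof -
  obtain cs where cs: "foldr (shift M) cs v = 0"
    and min: "\<And>ds. foldr (shift M) ds v = 0 \<Longrightarrow> length cs \<le> length ds"
    using ex_has_least_nat[of "\<lambda>cs. foldr (shift M) cs v = 0" _ length]
      ex_annihilating_shifts[of M v] by blast
  have "eigenvalue M c" if c: "c \<in> set cs" for c
  proof -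
    obtain xs ys where split: "cs = xs @ c # ys" using c by (meson split_list)
    define w where "w = foldr (shift M) (xs @ ys) v"
    have "w \<noteq> 0" using min[of "xs @ ys"] unfolding w_def split by auto
    moreover have "shift M c w = 0"
      using cs unfolding split w_def by (simp add: foldr_shift_commute)
    ultimately show ?thesis unfolding eigenvalue_def shift_def by auto
  qed
  with cs that show ?thesis by blast
qed

text \<open>The analytic form of positive stability. It makes sense in every Banach algebra, so the
  integrals below can be treated at once for matrices and for complex numbers.\<close>

definition exp_decaying :: "'a::{real_normed_algebra_1,banach} \<Rightarrow> bool" where
  "exp_decaying M \<longleftrightarrow> (\<exists>C \<alpha>. \<alpha> > 0 \<and> (\<forall>s\<ge>0. norm (exp (- (s *\<^sub>R M))) \<le> C * exp (- (\<alpha> * s))))"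

lemma bounded_linear_mat_of_mult: "bounded_linear (\<lambda>x. mat_of x *v v)"
  by (rule bounded_linear_intro[where K="norm v"])
    (simp_all add: matrix_vector_mult_add_rdistrib scaleR_matrix_vector_mult norm_mat_of_mult_le)

lemma norm_smult: "norm (c *s (v::complex^'n)) = cmod c * norm v"
  by (simp add: norm_vec_def norm_mult L2_set_right_distrib)

lemma bounded_bilinear_smult: "bounded_bilinear (\<lambda>c (v::complex^'n). c *s v)"
  by standard (auto simp: vec_eq_iff algebra_simps norm_smult intro!: exI[of _ 1])

text \<open>This takes the place of the Jordan form. On such a vector e^(-sM) grows at most like a
  polynomial times e^(-s min Re c), and a rate \<alpha> strictly below all Re c absorbs the
  polynomial.\<close>

lemma exp_decay_on_shift_kernel:
  fixes M :: "complex^'n^'n"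
  assumes "foldr (shift M) cs z = 0" "\<And>c. c \<in> set cs \<Longrightarrow> Re c > \<alpha>"
  shows "\<exists>C. \<forall>s\<ge>0. norm (mat_of (exp (- (s *\<^sub>R cmat M))) *v z) \<le> C * exp (- (\<alpha> * s))"
  using assms
proof (induction cs arbitrary: z rule: rev_induct)
  case Nil
  then show ?case by (intro exI[of _ 0]) simp
next
  case (snoc c cs)
  txt \<open>Variation of constants: $e^{cs}e^{-sM}z$ has the derivative $-e^{cs}e^{-sM}(M-c)z$, which the
    induction hypothesis bounds.\<close>
  define E where "E s = exp (s *\<^sub>R (- cmat M))" for s :: real
  define \<delta> where "\<delta> = Re c - \<alpha>"
  have \<delta>: "\<delta> > 0" using snoc.prems by (simp add: \<delta>_def)
  obtain C where C: "\<And>s. s \<ge> 0 \<Longrightarrow> norm (mat_of (E s) *v shift M c z) \<le> C * exp (- (\<alpha> * s))"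
    using snoc.IH[of "shift M c z"] snoc.prems by (auto simp: E_def)
  have "0 \<le> C" using order_trans[OF norm_ge_zero C[of 0]] by simp
  define u where "u s = exp (s *\<^sub>R c) *s (mat_of (E s) *v z)" for s :: real
  define u' where "u' s = - (exp (s *\<^sub>R c) *s (mat_of (E s) *v shift M c z))" for s :: real
  \<comment> \<open>A primitive of the bound C e^(\<delta>s) for the derivative of u. The gap
    \<delta> > 0 keeps a factor s from appearing.\<close>
  define \<phi> where "\<phi> s = C / \<delta> * exp (\<delta> * s)" for s
  have u_deriv: "(u has_vector_derivative u' s) (at s)" for s
  proof -
    have E': "(E has_vector_derivative E s * (- cmat M)) (at s)"
      unfolding E_def by (rule exp_scaleR_has_vector_derivative_right)
    have "((\<lambda>s. exp (s *\<^sub>R c)) has_vector_derivative exp (s *\<^sub>R c) * c) (at s)"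
      by (rule exp_scaleR_has_vector_derivative_right)
    note D = bounded_bilinear.has_vector_derivative[OF bounded_bilinear_smult this
        bounded_linear.has_vector_derivative[OF bounded_linear_mat_of_mult E', of z]]
    have neg: "mat_of (E s * - cmat M) *v z = - (mat_of (E s) *v (M *v z))"
    proof -
      have "mat_of (E s * - cmat M) = - (mat_of (E s) ** M)"
        by (simp only: mult_minus_right mat_of_simps mat_of_cmat)
      moreover have "(- X) *v z = - (X *v z)" for X :: "complex^'n^'n"
        by (simp add: vec_eq_iff matrix_vector_mult_def sum_negf)
      ultimately show ?thesis by (simp only: matrix_vector_mul_assoc)
    qed
    show ?thesis
      unfolding u_def
      by (rule has_vector_derivative_eq_rhs[OF D])
        (simp only: neg, simp add: u'_def shift_def matrix_vector_mult_diff_distrib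
          matrix_vector_mult_smult vec_eq_iff algebra_simps)
  qed
  have \<phi>_deriv: "(\<phi> has_vector_derivative C * exp (\<delta> * s)) (at s)" for s
    unfolding \<phi>_def using \<delta>
    by (auto intro!: derivative_eq_intros simp: has_real_derivative_iff_has_vector_derivative[symmetric])
  have u'_le: "norm (u' s) \<le> C * exp (\<delta> * s)" if "s \<ge> 0" for s
  proof -
    have "norm (u' s) = exp (s * Re c) * norm (mat_of (E s) *v shift M c z)"
      by (simp add: u'_def norm_smult)
    also have "\<dots> \<le> exp (s * Re c) * (C * exp (- (\<alpha> * s)))"
      using C[OF that] by simp
    also have "\<dots> = C * exp (\<delta> * s)"
      by (simp add: \<delta>_def algebra_simps flip: exp_add)
    finally show ?thesis .
  qed
  have u_le: "norm (u s) \<le> norm z + C / \<delta> * exp (\<delta> * s)" if "s \<ge> 0" for s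
  proof (cases "s = 0")
    case True
    then show ?thesis using \<open>0 \<le> C\<close> \<delta> by (simp add: u_def E_def)
  next
    case False
    with that have "0 < s" by simp
    have "norm (u s - u 0) \<le> \<phi> s - \<phi> 0"
      using \<open>0 < s\<close>
    proof (rule differentiable_bound_general[where f'=u' and \<phi>'="\<lambda>s. C * exp (\<delta> * s)"])
      show "continuous_on {0..s} u"
        using u_deriv by (auto intro!: continuous_at_imp_continuous_on has_vector_derivative_continuous)
      show "continuous_on {0..s} \<phi>"
        unfolding \<phi>_def by (intro continuous_intros)
    qed (auto intro: u_deriv \<phi>_deriv u'_le)
    moreover have "\<phi> 0 \<ge> 0" using \<open>0 \<le> C\<close> \<delta> by (simp add: \<phi>_def)
    moreover have "u 0 = z" by (simp add: u_def E_def)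
    ultimately show ?thesis
      using norm_triangle_ineq2[of "u s" "u 0"] by (simp add: \<phi>_def)
  qed
  show ?case
  proof (intro exI allI impI)
    fix s :: real assume s: "s \<ge> 0"
    have "norm (mat_of (E s) *v z) = exp (- (s * Re c)) * norm (u s)"
      by (simp add: u_def norm_smult exp_minus field_simps)
    also have "\<dots> \<le> exp (- (s * Re c)) * (norm z + C / \<delta> * exp (\<delta> * s))"
      using u_le[OF s] by simp
    also have "\<dots> = exp (- (s * Re c)) * norm z + C / \<delta> * exp (- (\<alpha> * s))"
      by (simp add: \<delta>_def algebra_simps flip: exp_add)
    also have "\<dots> \<le> exp (- (\<alpha> * s)) * norm z + C / \<delta> * exp (- (\<alpha> * s))"
      using mult_left_mono[of \<alpha> "Re c" s] s \<delta>
      by (intro add_mono mult_right_mono) (auto simp: \<delta>_def mult.commute)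
    finally show "norm (mat_of (exp (- (s *\<^sub>R cmat M))) *v z) \<le> (norm z + C / \<delta>) * exp (- (\<alpha> * s))"
      by (simp add: E_def algebra_simps)
  qed
qed

text \<open>Reduces the decay of a matrix to its decay on the finitely many basis vectors.\<close>

lemma norm_cmat_le_sum_columns: "norm x \<le> (\<Sum>j\<in>UNIV. norm (mat_of x *v axis j 1))"
proof -
  have "onorm ((*v) (mat_of x)) \<le> (\<Sum>j\<in>UNIV. norm (mat_of x *v axis j 1))"
  proof (rule onorm_bound)
    fix v :: "complex^'a"
    have "mat_of x *v v = (\<Sum>j\<in>UNIV. v $ j *s (mat_of x *v axis j 1))"
      by (simp add: vec_eq_iff matrix_vector_mult_def axis_def if_distrib mult.commute cong: if_cong)
    also have "norm \<dots> \<le> (\<Sum>j\<in>UNIV. norm (mat_of x *v axis j 1) * norm v)"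
      by (rule sum_norm_le)
        (simp add: norm_smult mult.commute[of _ "norm v"] mult_right_mono Finite_Cartesian_Product.norm_nth_le)
    finally show "norm (mat_of x *v v) \<le> (\<Sum>j\<in>UNIV. norm (mat_of x *v axis j 1)) * norm v"
      by (simp add: sum_distrib_right)
  qed (simp add: sum_nonneg)
  then show ?thesis by transfer
qed

lemma positive_stable_exp_decaying:
  fixes M :: "complex^'n^'n"
  assumes "positive_stable M"
  shows "exp_decaying (cmat M)"
proof -
  have "\<exists>\<alpha>>0. \<exists>C. \<forall>s\<ge>0. norm (mat_of (exp (- (s *\<^sub>R cmat M))) *v axis j 1) \<le> C * exp (- (\<alpha> * s))" for j :: 'n
  proof -
    obtain cs where cs: "foldr (shift M) cs (axis j 1) = 0" "\<And>c. c \<in> set cs \<Longrightarrow> eigenvalue M c"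
      using ex_annihilating_eigenvalues by blast
    \<comment> \<open>Half of the least real part lies strictly below all of them; the inserted 1
      keeps the set nonempty without a case distinction.\<close>
    define \<alpha> where "\<alpha> = Min (insert 1 (Re ` set cs)) / 2"
    have "Re c > 0" if "c \<in> set cs" for c
      using assms cs(2)[OF that] by (simp add: positive_stable_def)
    then have "Min (insert 1 (Re ` set cs)) > 0" by (subst Min_gr_iff) auto
    then have \<alpha>: "0 < \<alpha>" "\<alpha> < Min (insert 1 (Re ` set cs))" by (simp_all add: \<alpha>_def)
    moreover have "Re c > \<alpha>" if "c \<in> set cs" for c
      using that \<alpha>(2) by (subst (asm) Min_gr_iff) auto
    ultimately show ?thesis using exp_decay_on_shift_kernel[OF cs(1)] by blast
  qed
  then obtain a C where a: "\<And>j. a j > 0"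
    and C: "\<And>j s. s \<ge> 0 \<Longrightarrow> norm (mat_of (exp (- (s *\<^sub>R cmat M))) *v axis (j::'n) 1) \<le> C j * exp (- (a j * s))"
    by metis
  define \<alpha> where "\<alpha> = Min (range a)"
  have \<alpha>: "\<alpha> > 0" "\<And>j. \<alpha> \<le> a j" using a by (auto simp: \<alpha>_def)
  have "norm (exp (- (s *\<^sub>R cmat M))) \<le> (\<Sum>j\<in>UNIV. C j) * exp (- (\<alpha> * s))" if s: "s \<ge> 0" for s
  proof -
    have C0: "0 \<le> C j" for j using order_trans[OF norm_ge_zero C[of 0 j]] by simp
    have "norm (exp (- (s *\<^sub>R cmat M))) \<le> (\<Sum>j\<in>UNIV. norm (mat_of (exp (- (s *\<^sub>R cmat M))) *v axis j 1))"
      by (rule norm_cmat_le_sum_columns)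
    also have "\<dots> \<le> (\<Sum>j\<in>UNIV. C j * exp (- (a j * s)))" by (intro sum_mono C s)
    also have "\<dots> \<le> (\<Sum>j\<in>UNIV. C j * exp (- (\<alpha> * s)))"
      using s \<alpha> C0 by (intro sum_mono mult_left_mono) (auto intro!: mult_right_mono)
    finally show ?thesis by (simp add: sum_distrib_right)
  qed
  with \<alpha>(1) show ?thesis unfolding exp_decaying_def by blast
qed

section \<open>Gamma and beta integrals in a Banach algebra\<close>

lemma isCont_exp_algebra:
  fixes x :: "'a::{real_normed_algebra_1,banach}"
  shows "isCont exp x"
proof -
  \<comment> \<open>The exponential series converges uniformly on every ball about 0; this one
    contains x.\<close>
  have "uniform_limit (ball 0 (norm x + 1)) (\<lambda>n x. \<Sum>i<n. x ^ i /\<^sub>R fact i)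
      (\<lambda>x :: 'a. \<Sum>i. x ^ i /\<^sub>R fact i) sequentially"
  proof (rule Weierstrass_m_test)
    show "norm (y ^ n /\<^sub>R fact n) \<le> (norm x + 1) ^ n /\<^sub>R fact n" if "y \<in> ball 0 (norm x + 1)" for y :: 'a and n
    proof -
      have "norm y \<le> norm x + 1" using that by simp
      then have "norm (y ^ n) \<le> (norm x + 1) ^ n"
        by (intro order_trans[OF norm_power_ineq] power_mono) auto
      then show ?thesis by (simp add: divide_simps)
    qed
    show "summable (\<lambda>n. (norm x + 1) ^ n /\<^sub>R fact n)" by (rule summable_exp_generic)
  qed
  then have "continuous_on (ball 0 (norm x + 1)) (\<lambda>x :: 'a. \<Sum>i. x ^ i /\<^sub>R fact i)"
    by (rule uniform_limit_theorem[rotated]) (auto intro!: always_eventually continuous_intros)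
  then show ?thesis
    by (simp add: exp_def[abs_def] continuous_on_eq_continuous_at)
qed

lemma tendsto_exp_algebra:
  fixes f :: "'b \<Rightarrow> 'a::{real_normed_algebra_1,banach}"
  shows "(f \<longlongrightarrow> l) F \<Longrightarrow> ((\<lambda>x. exp (f x)) \<longlongrightarrow> exp l) F"
  by (rule isCont_tendsto_compose[OF isCont_exp_algebra])

lemma borel_measurable_exp_algebra [measurable (raw)]:
  fixes f :: "'b \<Rightarrow> 'a::{real_normed_algebra_1,banach}"
  assumes "f \<in> borel_measurable M"
  shows "(\<lambda>x. exp (f x)) \<in> borel_measurable M"
  by (rule measurable_compose[OF assms borel_measurable_continuous_onI])
    (simp add: continuous_at_imp_continuous_on isCont_exp_algebra)

lemma exp_add_scaleR_one:
  fixes x :: "'a::{real_normed_algebra_1,banach}"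
  shows "exp (x + r *\<^sub>R 1) = exp r *\<^sub>R exp x"
proof -
  have "exp (x + r *\<^sub>R 1) = exp x * exp (of_real r)"
    by (subst exp_add_commuting) (auto simp: of_real_def)
  then show ?thesis by (simp add: exp_of_real) (simp add: of_real_def)
qed

lemma exp_commute:
  fixes x y :: "'a::{real_normed_algebra_1,banach}"
  assumes "x * y = y * x"
  shows "x * exp y = exp y * x"
proof -
  have "x * y ^ n = y ^ n * x" for n
    using power_commuting_commutes[OF assms[symmetric], of n] by simp
  then have "(\<lambda>n. x * (y ^ n /\<^sub>R fact n)) = (\<lambda>n. (y ^ n /\<^sub>R fact n) * x)" by simp
  moreover have "(\<lambda>n. x * (y ^ n /\<^sub>R fact n)) sums (x * exp y)"
    by (intro sums_mult exp_converges)
  moreover have "(\<lambda>n. (y ^ n /\<^sub>R fact n) * x) sums (exp y * x)"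
    by (intro sums_mult2 exp_converges)
  ultimately show ?thesis using sums_unique2 by metis
qed

section \<open>Powers of a positive real with exponent in the algebra\<close>

definition rpow :: "real \<Rightarrow> 'a::{real_normed_algebra_1,banach} \<Rightarrow> 'a" where
  "rpow t M = exp (ln t *\<^sub>R M)"

lemma rpow_measurable [measurable (raw)]:
  fixes M :: "'a::{real_normed_algebra_1,banach,second_countable_topology}"
  assumes "f \<in> borel_measurable N"
  shows "(\<lambda>x. rpow (f x) M) \<in> borel_measurable N"
  unfolding rpow_def using assms by measurable

lemma rpow_add:
  assumes "M * N = N * M"
  shows "rpow t (M + N) = rpow t M * rpow t N"
  unfolding rpow_def scaleR_add_right using assms by (intro exp_add_commuting) simp

lemma rpow_add_real: "t > 0 \<Longrightarrow> rpow t (M + r *\<^sub>R 1) = (t powr r) *\<^sub>R rpow t M"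
  using exp_add_scaleR_one[of "ln t *\<^sub>R M" "ln t * r"]
  by (simp add: rpow_def scaleR_add_right powr_def mult.commute)

lemma rpow_diff_one: "t > 0 \<Longrightarrow> rpow t (M - 1) = (1 / t) *\<^sub>R rpow t M"
  using rpow_add_real[of t M "-1"] by (simp add: powr_minus_divide)

lemma rpow_mult: "s > 0 \<Longrightarrow> t > 0 \<Longrightarrow> rpow (s * t) M = rpow s M * rpow t M"
  unfolding rpow_def by (simp add: ln_mult scaleR_add_left exp_add_commuting)

text \<open>For t \<le> 1 the choice s = -ln t \<ge> 0 turns the decay of e^(-sM) into a bound of
  t^M by C t^\<alpha>.\<close>

lemma norm_rpow_le_of_decaying:
  assumes "exp_decaying M"
  obtains C \<alpha> where "\<alpha> > 0" "C \<ge> 0"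
    "\<And>t. 0 < t \<Longrightarrow> t \<le> 1 \<Longrightarrow> norm (rpow t (M - 1)) \<le> C * t powr (\<alpha> - 1)"
proof -
  obtain C \<alpha> where \<alpha>: "\<alpha> > 0"
    and C: "\<And>s. s \<ge> 0 \<Longrightarrow> norm (exp (- (s *\<^sub>R M))) \<le> C * exp (- (\<alpha> * s))"
    using assms unfolding exp_decaying_def by blast
  have "norm (rpow t (M - 1)) \<le> C * t powr (\<alpha> - 1)" if t: "0 < t" "t \<le> 1" for t
  proof -
    have "norm (rpow t M) \<le> C * t powr \<alpha>"
      using C[of "- ln t"] t by (simp add: rpow_def powr_def)
    then have "1 / t * norm (rpow t M) \<le> 1 / t * (C * t powr \<alpha>)"
      using t by (intro mult_left_mono) auto
    then show ?thesis
      using t by (simp add: rpow_diff_one powr_diff)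
  qed
  moreover have "C \<ge> 0" using order_trans[OF norm_ge_zero C[of 0]] by simp
  ultimately show ?thesis using that[OF \<alpha>] by simp
qed

lemma norm_rpow_le_ge_1:
  assumes "t \<ge> 1"
  shows "norm (rpow t M) \<le> t powr norm M"
  using norm_exp[of "ln t *\<^sub>R M"] assms by (simp add: rpow_def powr_def mult.commute)

text \<open>Decay gives the bound up to 1, the norm of the exponent gives it beyond. The second
  exponent is written with a final - 1 so that both summands fit
  \<open>set_integrable_real_Gamma\<close>.\<close>

lemma norm_rpow_le:
  assumes "exp_decaying M"
  obtains C \<alpha> where "\<alpha> > 0" "C \<ge> 0"
    "\<And>t. 0 < t \<Longrightarrow> norm (rpow t (M - 1)) \<le> C * t powr (\<alpha> - 1) + t powr ((norm (M - 1) + 1) - 1)"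
proof -
  obtain C \<alpha> where C: "\<alpha> > 0" "C \<ge> 0"
    "\<And>t. 0 < t \<Longrightarrow> t \<le> 1 \<Longrightarrow> norm (rpow t (M - 1)) \<le> C * t powr (\<alpha> - 1)"
    by (rule norm_rpow_le_of_decaying[OF assms]) (rule that, assumption+)
  have "norm (rpow t (M - 1)) \<le> C * t powr (\<alpha> - 1) + t powr ((norm (M - 1) + 1) - 1)" if t: "0 < t" for t
  proof (cases "t \<le> 1")
    case True
    show ?thesis by (rule order_trans[OF C(3)[OF t True]]) simp
  next
    case False
    then have "norm (rpow t (M - 1)) \<le> t powr norm (M - 1)" by (intro norm_rpow_le_ge_1) simp
    also have "\<dots> \<le> C * t powr (\<alpha> - 1) + t powr ((norm (M - 1) + 1) - 1)" using C(2) by simp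
    finally show ?thesis .
  qed
  then show ?thesis by (rule that[OF C(1,2)])
qed

section \<open>Convergence of the gamma and beta integrals\<close>

lemma set_integrable_real_Gamma:
  assumes "a > (0::real)"
  shows "set_integrable lborel {0<..} (\<lambda>t. t powr (a - 1) * exp (- t))"
  unfolding set_integrable_def
proof (rule integrableI_nonneg)
  have "(\<integral>\<^sup>+ t. ennreal (indicator {0<..} t *\<^sub>R (t powr (a - 1) * exp (- t))) \<partial>lborel)
      = (\<integral>\<^sup>+ t. ennreal (indicator {0..} t * t powr (a - 1) / exp t) \<partial>lborel)"
    by (rule nn_integral_cong) (auto simp: indicator_def exp_minus field_simps)
  also have "\<dots> < \<infinity>" using Gamma_conv_nn_integral_real[OF assms, symmetric] by simp
  finally show "(\<integral>\<^sup>+ t. ennreal (indicator {0<..} t *\<^sub>R (t powr (a - 1) * exp (- t))) \<partial>lborel) < \<infinity>" .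
qed auto

definition alg_Gamma :: "'a::{real_normed_algebra_1,banach,second_countable_topology} \<Rightarrow> 'a" where
  "alg_Gamma M = (LBINT t:{0<..}. exp (- t) *\<^sub>R rpow t (M - 1))"

definition alg_Beta :: "'a::{real_normed_algebra_1,banach,second_countable_topology} \<Rightarrow> 'a \<Rightarrow> 'a" where
  "alg_Beta M N = (LBINT u:{0<..<1}. rpow u (M - 1) * rpow (1 - u) (N - 1))"

lemma set_integrable_alg_Gamma:
  fixes M :: "'a::{real_normed_algebra_1,banach,second_countable_topology}"
  assumes "exp_decaying M"
  shows "set_integrable lborel {0<..} (\<lambda>t. exp (- t) *\<^sub>R rpow t (M - 1))"
proof -
  obtain C \<alpha> where C: "\<alpha> > 0" "C \<ge> 0"
    "\<And>t. 0 < t \<Longrightarrow> norm (rpow t (M - 1)) \<le> C * t powr (\<alpha> - 1) + t powr ((norm (M - 1) + 1) - 1)"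
    by (rule norm_rpow_le[OF assms]) (rule that, assumption+)
  have "set_integrable lborel {0<..}
    (\<lambda>t. C * (t powr (\<alpha> - 1) * exp (- t)) + t powr ((norm (M - 1) + 1) - 1) * exp (- t))"
    using C(1) by (intro set_integral_add set_integrable_mult_right set_integrable_real_Gamma) (auto simp: add_nonneg_pos)
  then show ?thesis
    unfolding set_integrable_def
  proof (rule Bochner_Integration.integrable_bound, safe intro!: AE_I2)
    fix t :: real
    show "norm (indicator {0<..} t *\<^sub>R exp (- t) *\<^sub>R rpow t (M - 1)) \<le>
      norm (indicator {0<..} t *\<^sub>R (C * (t powr (\<alpha> - 1) * exp (- t)) + t powr ((norm (M - 1) + 1) - 1) * exp (- t)))"
    proof (cases "t > 0")
      case True
      have "exp (- t) * norm (rpow t (M - 1)) \<le> exp (- t) * (C * t powr (\<alpha> - 1) + t powr ((norm (M - 1) + 1) - 1))"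
        using C(3)[OF True] by (intro mult_left_mono) auto
      also have "\<dots> \<le> \<bar>C * (t powr (\<alpha> - 1) * exp (- t)) + t powr ((norm (M - 1) + 1) - 1) * exp (- t)\<bar>"
        by (simp add: algebra_simps)
      finally show ?thesis using True by simp
    qed simp
  qed measurable
qed

lemma set_integrable_real_Beta:
  assumes "a > (0::real)" "b > 0"
  shows "set_integrable lborel {0<..<1} (\<lambda>u. u powr (a - 1) * (1 - u) powr (b - 1))"
  by (rule set_integrable_subset[OF integrable_Beta[OF assms]]) auto

text \<open>The product of the two norms is the majorant that is reused whenever further bounded
  factors multiply the beta integrand.\<close>

lemma set_integrable_alg_Beta_norm:
  fixes M N :: "'a::{real_normed_algebra_1,banach,second_countable_topology}"
  assumes "exp_decaying M" "exp_decaying N"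
  shows "set_integrable lborel {0<..<1} (\<lambda>u. norm (rpow u (M - 1)) * norm (rpow (1 - u) (N - 1)))"
proof -
  obtain C \<alpha> where C: "\<alpha> > 0" "C \<ge> 0"
    "\<And>t. 0 < t \<Longrightarrow> t \<le> 1 \<Longrightarrow> norm (rpow t (M - 1)) \<le> C * t powr (\<alpha> - 1)"
    by (rule norm_rpow_le_of_decaying[OF assms(1)]) (rule that, assumption+)
  obtain D \<beta> where D: "\<beta> > 0" "D \<ge> 0"
    "\<And>t. 0 < t \<Longrightarrow> t \<le> 1 \<Longrightarrow> norm (rpow t (N - 1)) \<le> D * t powr (\<beta> - 1)"
    by (rule norm_rpow_le_of_decaying[OF assms(2)]) (rule that, assumption+)
  have "set_integrable lborel {0<..<1} (\<lambda>u. (C * D) * (u powr (\<alpha> - 1) * (1 - u) powr (\<beta> - 1)))"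
    using C(1) D(1) by (intro set_integrable_mult_right set_integrable_real_Beta) auto
  then show ?thesis
    unfolding set_integrable_def
  proof (rule Bochner_Integration.integrable_bound, safe intro!: AE_I2)
    fix u :: real
    have "norm (rpow u (M - 1)) * norm (rpow (1 - u) (N - 1)) \<le>
      (C * u powr (\<alpha> - 1)) * (D * (1 - u) powr (\<beta> - 1))" if "u \<in> {0<..<1}"
      using that C(2) by (intro mult_mono C(3) D(3)) auto
    then show "norm (indicator {0<..<1} u *\<^sub>R (norm (rpow u (M - 1)) * norm (rpow (1 - u) (N - 1)))) \<le>
      norm (indicator {0<..<1} u *\<^sub>R ((C * D) * (u powr (\<alpha> - 1) * (1 - u) powr (\<beta> - 1))))"
      using C(2) D(2) by (auto simp: indicator_def mult_ac)
  qed measurable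
qed

lemma set_integrable_alg_Beta:
  fixes M N :: "'a::{real_normed_algebra_1,banach,second_countable_topology}"
  assumes "exp_decaying M" "exp_decaying N"
  shows "set_integrable lborel {0<..<1} (\<lambda>u. rpow u (M - 1) * rpow (1 - u) (N - 1))"
  using set_integrable_alg_Beta_norm[OF assms] unfolding set_integrable_def
  by (rule Bochner_Integration.integrable_bound)
    (auto simp: indicator_def norm_mult_ineq)

section \<open>Double integrals and the gamma-beta relation\<close>

lemma integrable_pair_times:
  fixes f g :: "real \<Rightarrow> 'a::{real_normed_algebra_1,banach,second_countable_topology}"
  assumes f: "integrable lborel f" and g: "integrable lborel g"
  shows "integrable (lborel \<Otimes>\<^sub>M lborel) (\<lambda>(x, y). f x * g y)"
proof -
  note [measurable] = borel_measurable_integrable[OF f] borel_measurable_integrable[OF g]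
  have "integrable (lborel \<Otimes>\<^sub>M lborel) (\<lambda>p. norm (f (fst p)) * norm (g (snd p)))"
    by (rule lborel_pair.Fubini_integrable) (use f g in auto)
  then show ?thesis
    by (rule Bochner_Integration.integrable_bound) (auto simp: norm_mult_ineq split: prod.split)
qed

text \<open>For almost every x the substitution y -> d(x) + c(x)y preserves the inner integral of
  the norm, so Fubini's criterion carries over. Planar substitutions are composed of such steps in
  one variable.\<close>

lemma integrable_pair_affine:
  fixes F :: "real \<Rightarrow> real \<Rightarrow> 'a::{banach,second_countable_topology}"
  assumes F: "integrable (lborel \<Otimes>\<^sub>M lborel) (\<lambda>(x, y). F x y)"
    and [measurable]: "c \<in> borel_measurable borel" "d \<in> borel_measurable borel"
    and c: "AE x in lborel. c x \<noteq> 0"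
  shows "integrable (lborel \<Otimes>\<^sub>M lborel) (\<lambda>(x, y). \<bar>c x\<bar> *\<^sub>R F x (d x + c x * y))"
proof (rule lborel_pair.Fubini_integrable)
  note [measurable] = borel_measurable_integrable[OF F]
  have "integrable lborel (\<lambda>x. \<integral>y. norm (F x y) \<partial>lborel)"
    using lborel_pair.integrable_fst'[OF integrable_norm[OF F]] by simp
  also have "?this \<longleftrightarrow> integrable lborel (\<lambda>x. \<integral>y. \<bar>c x\<bar> * norm (F x (d x + c x * y)) \<partial>lborel)"
  proof (rule integrable_cong_AE)
    show "AE x in lborel. (\<integral>y. norm (F x y) \<partial>lborel) = (\<integral>y. \<bar>c x\<bar> * norm (F x (d x + c x * y)) \<partial>lborel)"
      using c by eventually_elim (subst lborel_integral_real_affine, auto)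
  qed measurable
  finally show "integrable lborel
    (\<lambda>x. \<integral>y. norm (case (x, y) of (x, y) \<Rightarrow> \<bar>c x\<bar> *\<^sub>R F x (d x + c x * y)) \<partial>lborel)"
    by simp
  show "AE x in lborel. integrable lborel (\<lambda>y. case (x, y) of (x, y) \<Rightarrow> \<bar>c x\<bar> *\<^sub>R F x (d x + c x * y))"
    using c lborel_pair.AE_integrable_fst'[OF F]
    by eventually_elim (auto intro!: lborel_integrable_real_affine)
qed (use assms in measurable)

text \<open>The scalar proof by a double integral over the quadrant survives, because MN = NM makes
  all powers of M and N commute.\<close>

lemma alg_Gamma_mult_Gamma:
  fixes M N :: "'a::{real_normed_algebra_1,banach,second_countable_topology}"
  assumes M: "exp_decaying M" and N: "exp_decaying N" and MN: "exp_decaying (M + N)"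
    and comm: "M * N = N * M"
  shows "alg_Gamma M * alg_Gamma N = alg_Gamma (M + N) * alg_Beta M N"
proof -
  define g where "g L t = indicator {0<..} t *\<^sub>R exp (- t) *\<^sub>R rpow t (L - 1)" for L :: 'a and t
  define b where "b u = indicator {0<..<1} u *\<^sub>R (rpow u (M - 1) * rpow (1 - u) (N - 1))" for u
  have int_g: "integrable lborel (g L)" if "exp_decaying L" for L
    using set_integrable_alg_Gamma[OF that] by (simp add: set_integrable_def g_def[abs_def])
  have int_b: "integrable lborel b"
    using set_integrable_alg_Beta[OF M N] by (simp add: set_integrable_def b_def[abs_def])
  have Gamma: "alg_Gamma L = integral\<^sup>L lborel (g L)" for L
    by (simp add: alg_Gamma_def set_lebesgue_integral_def g_def[abs_def])
  have Beta: "alg_Beta M N = integral\<^sup>L lborel b"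
    by (simp add: alg_Beta_def set_lebesgue_integral_def b_def[abs_def])
  txt \<open>The substitution is $s = um$, $t = u(1-m)$, carried out in two affine steps.\<close>
  have int1: "integrable (lborel \<Otimes>\<^sub>M lborel) (\<lambda>(s, t). g M s * g N t)"
    by (intro integrable_pair_times int_g M N)
  have int2: "integrable (lborel \<Otimes>\<^sub>M lborel) (\<lambda>(s, u). g M s * g N (u - s))"
    using integrable_pair_affine[OF int1, of "\<lambda>_. 1" "\<lambda>s. - s"] by simp
  \<comment> \<open>The swap makes s the inner variable, on which the next step s = um acts.\<close>
  then have int3: "integrable (lborel \<Otimes>\<^sub>M lborel) (\<lambda>(u, s). g M s * g N (u - s))"
    using lborel_pair.integrable_product_swap[OF int2] by (simp add: split_def)
  have int4: "integrable (lborel \<Otimes>\<^sub>M lborel) (\<lambda>(u, m). \<bar>u\<bar> *\<^sub>R (g M (u * m) * g N (u - u * m)))"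
    using integrable_pair_affine[OF int3, of "\<lambda>u. u" "\<lambda>_. 0"] AE_lborel_singleton[of 0] by simp
  have split: "\<bar>u\<bar> *\<^sub>R (g M (u * m) * g N (u - u * m)) = g (M + N) u * b m" for u m
  proof (cases "u > 0 \<and> 0 < m \<and> m < 1")
    case True
    have [simp]: "u - u * m > 0" "u * m > 0" "1 - m > 0"
      using True by (auto simp: algebra_simps)
    have u: "rpow (u - u * m) L = rpow u L * rpow (1 - m) L" for L :: 'a
      using True rpow_mult[of u "1 - m" L] by (simp add: algebra_simps)
    have comm': "rpow m (M - 1) * rpow u (N - 1) = rpow u (N - 1) * rpow m (M - 1)"
      unfolding rpow_def using comm
      by (intro exp_commute exp_commute[symmetric]) (simp add: algebra_simps)
    \<comment> \<open>The two exponents together contain -2I, one I more than u^(M+N-I) allows; the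
      Jacobian u compensates for it.\<close>
    have "rpow u (M - 1) * rpow u (N - 1) = rpow u (((M + N) - 1) - 1)"
      using comm by (subst rpow_add[symmetric]) (simp_all add: algebra_simps)
    also have "\<dots> = (1 / u) *\<^sub>R rpow u ((M + N) - 1)"
      using True by (subst rpow_diff_one) auto
    finally have add: "rpow u (M - 1) * rpow u (N - 1) = (1 / u) *\<^sub>R rpow u ((M + N) - 1)" .
    have "rpow u (M - 1) * rpow m (M - 1) * (rpow u (N - 1) * rpow (1 - m) (N - 1))
      = (rpow u (M - 1) * rpow u (N - 1)) * (rpow m (M - 1) * rpow (1 - m) (N - 1))"
      by (simp add: mult.assoc) (simp add: comm' flip: mult.assoc)
    also have "\<dots> = (1 / u) *\<^sub>R (rpow u ((M + N) - 1) * (rpow m (M - 1) * rpow (1 - m) (N - 1)))"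
      by (simp add: add)
    finally have prod: "rpow u (M - 1) * rpow m (M - 1) * (rpow u (N - 1) * rpow (1 - m) (N - 1))
      = (1 / u) *\<^sub>R (rpow u ((M + N) - 1) * (rpow m (M - 1) * rpow (1 - m) (N - 1)))" .
    have exps: "exp (- (u * m)) * exp (- (u - u * m)) = exp (- u)"
      by (simp flip: exp_add)
    have "\<bar>u\<bar> *\<^sub>R (g M (u * m) * g N (u - u * m)) = (u * (exp (- (u * m)) * exp (- (u - u * m)))) *\<^sub>R
        (rpow u (M - 1) * rpow m (M - 1) * (rpow u (N - 1) * rpow (1 - m) (N - 1)))"
      using True unfolding g_def u by (simp add: rpow_mult)
    also have "\<dots> = g (M + N) u * b m"
      unfolding prod exps using True by (simp add: g_def b_def)
    finally show ?thesis .
  next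
    case False
    \<comment> \<open>For u > 0 both um and u(1 - m) are positive only if 0 < m < 1; for u < 0 this
      would need m < 0 and m > 1.\<close>
    have "u = 0 \<or> \<not> (0 < u * m \<and> 0 < u * (1 - m))"
      using False by (cases "u > 0") (auto simp: zero_less_mult_iff)
    then have "\<bar>u\<bar> *\<^sub>R (g M (u * m) * g N (u - u * m)) = 0"
      by (auto simp: g_def indicator_def right_diff_distrib)
    moreover have "g (M + N) u * b m = 0" using False by (auto simp: g_def b_def)
    ultimately show ?thesis by simp
  qed
  have "alg_Gamma M * alg_Gamma N = (\<integral>s. (\<integral>t. g M s * g N t \<partial>lborel) \<partial>lborel)"
    unfolding Gamma using int_g[OF M] int_g[OF N]
    by (simp add: integral_mult_right_zero)
  also have "\<dots> = (\<integral>s. (\<integral>u. g M s * g N (u - s) \<partial>lborel) \<partial>lborel)"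
    using lborel_integral_real_affine[of 1 "\<lambda>t. g M s * g N t" "- s" for s] by simp
  also have "\<dots> = (\<integral>u. (\<integral>s. g M s * g N (u - s) \<partial>lborel) \<partial>lborel)"
    using lborel_pair.Fubini_integral[OF int3] by simp
  also have "\<dots> = (\<integral>u. (\<integral>m. \<bar>u\<bar> *\<^sub>R (g M (u * m) * g N (u - u * m)) \<partial>lborel) \<partial>lborel)"
  proof (rule integral_cong_AE)
    show "AE u in lborel. (\<integral>s. g M s * g N (u - s) \<partial>lborel) =
        (\<integral>m. \<bar>u\<bar> *\<^sub>R (g M (u * m) * g N (u - u * m)) \<partial>lborel)"
      using AE_lborel_singleton[of 0]
    proof eventually_elim
      case (elim u)
      then show ?case by (subst lborel_integral_real_affine[where c=u and t=0]) auto
    qed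
  qed (use int3 int4 in \<open>auto intro!: borel_measurable_integrable lborel_pair.integrable_fst\<close>)
  also have "\<dots> = (\<integral>u. g (M + N) u * alg_Beta M N \<partial>lborel)"
    unfolding split Beta using int_b by simp
  also have "\<dots> = alg_Gamma (M + N) * alg_Beta M N"
    unfolding Gamma using int_g[OF MN] by simp
  finally show ?thesis .
qed

section \<open>The gamma function of a positive stable matrix\<close>

lemma exp_decaying_add_scaleR_one:
  assumes "exp_decaying M" "r \<ge> 0"
  shows "exp_decaying (M + r *\<^sub>R 1)"
proof -
  obtain C \<alpha> where \<alpha>: "\<alpha> > 0"
    and C: "\<And>s. s \<ge> 0 \<Longrightarrow> norm (exp (- (s *\<^sub>R M))) \<le> C * exp (- (\<alpha> * s))"
    using assms(1) unfolding exp_decaying_def by blast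
  have "norm (exp (- (s *\<^sub>R (M + r *\<^sub>R 1)))) \<le> C * exp (- (\<alpha> * s))" if s: "s \<ge> 0" for s
  proof -
    have "norm (exp (- (s *\<^sub>R (M + r *\<^sub>R 1)))) = exp (- (s * r)) * norm (exp (- (s *\<^sub>R M)))"
      using exp_add_scaleR_one[of "- (s *\<^sub>R M)" "- (s * r)"] by (simp add: scaleR_add_right)
    also have "\<dots> \<le> 1 * norm (exp (- (s *\<^sub>R M)))"
      using s assms(2) by (intro mult_right_mono) auto
    finally show ?thesis using C[OF s] by simp
  qed
  with \<alpha> show ?thesis unfolding exp_decaying_def by blast
qed

text \<open>No integrability is assumed: the default value 0 of a divergent integral commutes with
  everything. Commutation with an integral thus never requires a convergence proof.\<close>

lemma set_integral_mult_commute: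
  fixes f :: "real \<Rightarrow> 'a::{real_normed_algebra_1,banach,second_countable_topology}"
  assumes "\<And>t. t \<in> S \<Longrightarrow> f t * q = q * f t"
  shows "(LBINT t:S. f t) * q = q * (LBINT t:S. f t)"
proof (cases "set_integrable lborel S f")
  case True
  have "(LBINT t:S. f t) * q = (LBINT t:S. f t * q)"
    using True unfolding set_integrable_def set_lebesgue_integral_def
    by (subst Bochner_Integration.integral_mult_left[symmetric]) auto
  also have "\<dots> = (LBINT t:S. q * f t)"
    unfolding set_lebesgue_integral_def
    by (rule Bochner_Integration.integral_cong) (auto simp: indicator_def assms)
  also have "\<dots> = q * (LBINT t:S. f t)"
    using True unfolding set_integrable_def set_lebesgue_integral_def
    by (subst Bochner_Integration.integral_mult_right[symmetric]) auto
  finally show ?thesis .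
next
  case False
  then have "(LBINT t:S. f t) = 0"
    unfolding set_integrable_def set_lebesgue_integral_def by (rule not_integrable_integral_eq)
  then show ?thesis by simp
qed

lemma rpow_commute:
  assumes "M * q = q * M"
  shows "rpow t M * q = q * rpow t M"
  unfolding rpow_def by (rule exp_commute[symmetric]) (simp add: assms)

lemma has_vector_derivative_rpow:
  assumes "t > 0"
  shows "((\<lambda>t. rpow t M) has_vector_derivative (1 / t) *\<^sub>R (M * rpow t M)) (at t)"
proof -
  have "(ln has_vector_derivative 1 / t) (at t)"
    using assms by (auto intro!: derivative_eq_intros simp flip: has_real_derivative_iff_has_vector_derivative)
  from vector_diff_chain_at[OF this exp_scaleR_has_vector_derivative_left[of M "ln t"]]
  show ?thesis unfolding rpow_def[abs_def] o_def by simp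
qed

lemma isCont_rpow: "t > 0 \<Longrightarrow> isCont (\<lambda>t. rpow t M) t"
  by (rule has_vector_derivative_continuous[OF has_vector_derivative_rpow])

lemma tendsto_rpow_0:
  assumes "exp_decaying M"
  shows "((\<lambda>t. rpow t M) \<longlongrightarrow> 0) (at_right 0)"
proof -
  obtain C \<alpha> where C: "\<alpha> > 0" "C \<ge> 0"
    "\<And>t. 0 < t \<Longrightarrow> t \<le> 1 \<Longrightarrow> norm (rpow t (M - 1)) \<le> C * t powr (\<alpha> - 1)"
    by (rule norm_rpow_le_of_decaying[OF assms]) (rule that, assumption+)
  have "eventually (\<lambda>t::real. 0 \<le> t) (at_right 0)"
    by (rule eventually_mono[OF eventually_at_right_less]) simp
  then have "((\<lambda>t. t powr \<alpha>) \<longlongrightarrow> 0) (at_right 0)"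
    using C(1) by (intro tendsto_zero_powrI[OF tendsto_ident_at tendsto_const])
  from tendsto_mult_left[OF this, of C]
  have "((\<lambda>t. C * t powr \<alpha>) \<longlongrightarrow> 0) (at_right 0)" by simp
  moreover have "eventually (\<lambda>t. norm (rpow t M) \<le> C * t powr \<alpha>) (at_right 0)"
  proof -
    have "norm (rpow t M) \<le> C * t powr \<alpha>" if "t \<in> {0<..<1}" for t
      using C(3)[of t] that by (simp add: rpow_diff_one powr_diff divide_simps)
    then show ?thesis
      by (rule eventually_mono[OF eventually_at_right_real[of 0 1], rotated]) auto
  qed
  ultimately show ?thesis by (rule Lim_null_comparison[rotated])
qed

text \<open>For t \<ge> 1 the norm of t^M is at most a natural power of t, which the exponential
  beats.\<close>

lemma tendsto_exp_rpow_at_top: "((\<lambda>t. exp (- t) *\<^sub>R rpow t M) \<longlongrightarrow> 0) at_top"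
proof -
  define n where "n = nat \<lceil>norm M\<rceil>"
  have n: "norm M \<le> real n" by (simp add: n_def)
  have "eventually (\<lambda>t. norm (exp (- t) *\<^sub>R rpow t M) \<le> t ^ n / exp t) at_top"
    using eventually_ge_at_top[of 1]
  proof eventually_elim
    case (elim t)
    have "norm (rpow t M) \<le> t powr norm M" using elim by (rule norm_rpow_le_ge_1)
    also have "\<dots> \<le> t powr real n" using n elim by (intro powr_mono) auto
    finally show ?case
      using elim by (simp add: powr_realpow exp_minus divide_simps)
  qed
  then show ?thesis
    by (rule Lim_null_comparison) (rule tendsto_power_div_exp_0)
qed

text \<open>Integration by parts: F(t) = e^(-t) t^M vanishes at both ends, and its derivative f is
  the difference of the two integrands. The exponent M + 1 - 1 in f stays unsimplified to match the
  definition of Gamma(M + I).\<close>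

lemma alg_Gamma_plus_one:
  fixes M :: "'n::finite cmat"
  assumes "exp_decaying M"
  shows "alg_Gamma (M + 1) = M * alg_Gamma M"
proof -
  have M1: "exp_decaying (M + 1)" using exp_decaying_add_scaleR_one[OF assms, of 1] by simp
  define F where "F t = exp (- t) *\<^sub>R rpow t M" for t
  define f where "f t = M * (exp (- t) *\<^sub>R rpow t (M - 1)) - exp (- t) *\<^sub>R rpow t (M + 1 - 1)" for t
  have int1: "set_integrable lborel {0<..} (\<lambda>t. M * (exp (- t) *\<^sub>R rpow t (M - 1)))"
    using set_integrable_alg_Gamma[OF assms] unfolding set_integrable_def
    by (subst mult_scaleR_right[symmetric]) (intro integrable_mult_right, auto)
  note int2 = set_integrable_alg_Gamma[OF M1]
  have int: "set_integrable lborel {0<..} f"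
    unfolding f_def by (intro set_integral_diff int1 int2)
  have "(LBINT t:{0<..}. f t) = (LBINT t:{0<..}. M * (exp (- t) *\<^sub>R rpow t (M - 1))) - alg_Gamma (M + 1)"
    unfolding f_def alg_Gamma_def by (intro set_integral_diff int1 int2)
  also have "(LBINT t:{0<..}. M * (exp (- t) *\<^sub>R rpow t (M - 1))) = M * alg_Gamma M"
    using set_integrable_alg_Gamma[OF assms] unfolding alg_Gamma_def set_integrable_def set_lebesgue_integral_def
    by (subst Bochner_Integration.integral_mult_right[symmetric]) auto
  finally have eq: "(LBINT t:{0<..}. f t) = M * alg_Gamma M - alg_Gamma (M + 1)" .
  have deriv: "(F has_vector_derivative f t) (at t)" if "t > 0" for t
  proof -
    have "((\<lambda>t. exp (- t)) has_real_derivative - exp (- t)) (at t)"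
      by (auto intro!: derivative_eq_intros)
    from has_vector_derivative_scaleR[OF this has_vector_derivative_rpow[OF that, of M]]
    show ?thesis unfolding F_def f_def using that by (simp add: rpow_diff_one algebra_simps)
  qed
  have lim0: "(F \<longlongrightarrow> 0) (at_right 0)"
  proof -
    have "((\<lambda>t::real. exp (- t)) \<longlongrightarrow> exp (- 0)) (at_right 0)" by (intro tendsto_intros)
    from tendsto_scaleR[OF this tendsto_rpow_0[OF assms]] show ?thesis by (simp add: F_def[abs_def])
  qed
  \<comment> \<open>The fundamental theorem is applied after \<open>mat_of\<close>, where the values
    lie in a Euclidean space.\<close>
  have "(LBINT t=0..\<infinity>. mat_of (f t)) = mat_of 0 - mat_of 0"
  proof (rule interval_integral_FTC_integrable)
    show "((\<lambda>t. mat_of (F t)) has_vector_derivative mat_of (f t)) (at t)" if "0 < ereal t" for t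
      using that by (intro bounded_linear.has_vector_derivative[OF bounded_linear_mat_of] deriv) (simp add: zero_ereal_def)
    show "isCont (\<lambda>t. mat_of (f t)) t" if "0 < ereal t" for t
      using that unfolding f_def
      by (intro bounded_linear.isCont[OF bounded_linear_mat_of] continuous_intros isCont_rpow) (simp_all add: zero_ereal_def)
    show "set_integrable lborel (einterval 0 \<infinity>) (\<lambda>t. mat_of (f t))"
      using integrable_bounded_linear[OF bounded_linear_mat_of int[unfolded set_integrable_def]]
      by (simp add: set_integrable_def einterval_def zero_ereal_def greaterThan_def)
    show "(((\<lambda>t. mat_of (F t)) \<circ> real_of_ereal) \<longlongrightarrow> mat_of 0) (at_right 0)"
      unfolding zero_ereal_def ereal_tendsto_simps
      by (intro bounded_linear.tendsto[OF bounded_linear_mat_of] lim0)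
    show "(((\<lambda>t. mat_of (F t)) \<circ> real_of_ereal) \<longlongrightarrow> mat_of 0) (at_left \<infinity>)"
      unfolding ereal_tendsto_simps F_def
      by (intro bounded_linear.tendsto[OF bounded_linear_mat_of] tendsto_exp_rpow_at_top)
  qed simp_all
  then have "(LBINT t:{0<..}. mat_of (f t)) = 0"
    by (simp add: interval_lebesgue_integral_def einterval_def zero_ereal_def greaterThan_def)
  moreover have "(LBINT t:{0<..}. mat_of (f t)) = mat_of (LBINT t:{0<..}. f t)"
    using integral_bounded_linear[OF bounded_linear_mat_of int[unfolded set_integrable_def]]
    by (simp add: set_lebesgue_integral_def)
  ultimately have "mat_of (LBINT t:{0<..}. f t) = mat_of 0" by simp
  then have "(LBINT t:{0<..}. f t) = 0" by (simp only: mat_of_inject)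
  then show ?thesis using eq by simp
qed

section \<open>Gamma on eigenvectors and its invertibility\<close>

lemma power_eigenvector:
  assumes "mat_of x *v w = m *s w"
  shows "mat_of (x ^ n) *v w = m ^ n *s w"
  by (induction n)
    (simp_all add: assms matrix_vector_mult_smult vector_smult_assoc mult.commute flip: matrix_vector_mul_assoc)

lemma exp_eigenvector:
  assumes "mat_of x *v w = m *s w"
  shows "mat_of (exp x) *v w = exp m *s w"
proof -
  have "(\<lambda>n. mat_of (x ^ n /\<^sub>R fact n) *v w) sums (mat_of (exp x) *v w)"
    by (intro bounded_linear.sums[OF bounded_linear_mat_of_mult] exp_converges)
  moreover have "(\<lambda>n. mat_of (x ^ n /\<^sub>R fact n) *v w) = (\<lambda>n. (m ^ n /\<^sub>R fact n) *s w)"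
    by (rule ext) (simp only: mat_of_simps scaleR_matrix_vector_mult power_eigenvector[OF assms],
      simp add: vec_eq_iff)
  moreover have "(\<lambda>n. (m ^ n /\<^sub>R fact n) *s w) sums (exp m *s w)"
    by (intro bounded_linear.sums[OF bounded_bilinear.bounded_linear_left[OF bounded_bilinear_smult]] exp_converges)
  ultimately show ?thesis using sums_unique2 by metis
qed

lemma rpow_eigenvector:
  assumes "mat_of x *v w = m *s w"
  shows "mat_of (rpow t x) *v w = rpow t m *s w"
  unfolding rpow_def
  by (rule exp_eigenvector)
    (simp add: scaleR_matrix_vector_mult assms, simp add: vec_eq_iff)

lemma minus_one_eigenvector:
  assumes "mat_of x *v w = m *s w"
  shows "mat_of (x - 1) *v w = (m - 1) *s w"
  by (simp add: assms matrix_vector_mult_diff_rdistrib vector_sub_rdistrib)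

lemma exp_decaying_complex: "Re c > 0 \<Longrightarrow> exp_decaying c"
  unfolding exp_decaying_def
  by (intro exI[of _ 1] exI[of _ "Re c"]) (simp add: mult.commute)

text \<open>The link to the scalar \<open>Gamma\<close>, whose lack of zeros is what makes Gamma(M)
  invertible.\<close>

lemma alg_Gamma_complex:
  assumes "Re c > 0"
  shows "alg_Gamma c = Gamma c"
proof -
  have int: "set_integrable lborel {0<..} (\<lambda>t. exp (- t) *\<^sub>R rpow t (c - 1))"
    by (intro set_integrable_alg_Gamma exp_decaying_complex assms)
  have "((\<lambda>t. exp (- t) *\<^sub>R rpow t (c - 1)) has_integral Gamma c) {0<..}"
    by (rule has_integral_eq[OF _ Gamma_integral_complex'[OF assms]])
      (simp add: rpow_def powr_def Ln_of_real exp_minus scaleR_conv_of_real exp_of_real field_simps)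
  with set_borel_integral_eq_integral(2)[OF int] show ?thesis
    by (simp add: alg_Gamma_def integral_unique)
qed

lemma alg_Gamma_eigenvector:
  assumes M: "exp_decaying M" and w: "mat_of M *v w = c *s w" and c: "Re c > 0"
  shows "mat_of (alg_Gamma M) *v w = Gamma c *s w"
proof -
  have int: "set_integrable lborel {0<..} (\<lambda>t. exp (- t) *\<^sub>R rpow t (c - 1))"
    by (intro set_integrable_alg_Gamma exp_decaying_complex c)
  note bl = bounded_bilinear.bounded_linear_left[OF bounded_bilinear_smult, of w]
  have "mat_of (alg_Gamma M) *v w = (LBINT t:{0<..}. mat_of (exp (- t) *\<^sub>R rpow t (M - 1)) *v w)"
    using integral_bounded_linear[OF bounded_linear_mat_of_mult set_integrable_alg_Gamma[OF M, unfolded set_integrable_def], of w]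
    by (simp add: alg_Gamma_def set_lebesgue_integral_def scaleR_matrix_vector_mult)
  also have "\<dots> = (LBINT t:{0<..}. (exp (- t) *\<^sub>R rpow t (c - 1)) *s w)"
    by (simp only: mat_of_simps scaleR_matrix_vector_mult rpow_eigenvector[OF minus_one_eigenvector[OF w]])
      (simp add: vec_eq_iff bounded_bilinear.scaleR_left[OF bounded_bilinear_smult])
  also have "\<dots> = alg_Gamma c *s w"
    using integral_bounded_linear[OF bl int[unfolded set_integrable_def]]
    by (simp add: alg_Gamma_def set_lebesgue_integral_def bounded_bilinear.scaleR_left[OF bounded_bilinear_smult])
  finally show ?thesis by (simp add: alg_Gamma_complex[OF c])
qed

lemma invertible_of_trivial_kernel:
  fixes M :: "complex^'n^'n"
  assumes "\<And>v. M *v v = 0 \<Longrightarrow> v = 0"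
  shows "invertible M"
  using assms matrix_left_invertible_ker[of M] by (auto simp: invertible_left_inverse)

text \<open>A kernel vector of M + nI would be an eigenvector of M for -n, which has no positive
  real part.\<close>

lemma positive_stable_invertible_add_nat:
  fixes M :: "complex^'n^'n"
  assumes "positive_stable M"
  shows "invertible (M + mat (of_nat n))"
proof (rule invertible_of_trivial_kernel, rule ccontr)
  fix v assume v: "(M + mat (of_nat n)) *v v = 0" "v \<noteq> 0"
  have "mat (of_nat n) *v v = of_nat n *s v"
    by (simp add: vec_eq_iff matrix_vector_mult_def mat_def if_distrib if_distribR cong: if_cong)
  with v(1) have "M *v v = (- of_nat n) *s v"
    by (simp add: matrix_vector_mult_add_rdistrib eq_neg_iff_add_eq_0 vec_eq_iff)
  then have "eigenvalue M (- of_nat n)" using v(2) by (auto simp: eigenvalue_def)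
  with assms have "Re (- of_nat n) > 0" unfolding positive_stable_def by blast
  then show False by simp
qed

lemma invertible_mat_pochhammer:
  fixes M :: "complex^'n^'n"
  shows "positive_stable M \<Longrightarrow> invertible (mat_pochhammer M n)"
proof (induction n)
  case 0
  then show ?case by (auto simp: invertible_def)
next
  case (Suc n)
  then show ?case by (simp add: invertible_mult positive_stable_invertible_add_nat)
qed

lemma alg_Gamma_commute:
  assumes "M * q = q * M"
  shows "alg_Gamma M * q = q * alg_Gamma M"
  unfolding alg_Gamma_def
  by (rule set_integral_mult_commute) (simp add: rpow_commute assms algebra_simps)

text \<open>Gamma(M) commutes with M, so its kernel is invariant under M. A nonzero kernel would
  contain an eigenvector of M, on which Gamma(M) acts as the nonzero scalar Gamma(c).\<close>

lemma invertible_alg_Gamma: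
  fixes M :: "complex^'n^'n"
  assumes "positive_stable M"
  shows "invertible (mat_of (alg_Gamma (cmat M)))"
proof (rule invertible_of_trivial_kernel, rule ccontr)
  fix v assume v: "mat_of (alg_Gamma (cmat M)) *v v = 0" "v \<noteq> 0"
  define V where "V = {v. mat_of (alg_Gamma (cmat M)) *v v = 0}"
  have comm: "mat_of (alg_Gamma (cmat M)) ** M = M ** mat_of (alg_Gamma (cmat M))"
    using arg_cong[OF alg_Gamma_commute[of "cmat M" "cmat M"], of mat_of] by simp
  have inv: "shift M c w \<in> V" if "w \<in> V" for c w
    using that by (simp add: V_def shift_def matrix_vector_mult_diff_distrib matrix_vector_mult_smult
        matrix_vector_mul_assoc comm) (simp flip: matrix_vector_mul_assoc)
  have "v \<in> V" using v(1) by (simp add: V_def)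
  from ex_eigenvector_in_invariant[OF inv this v(2)]
  obtain c w where w: "w \<in> V" "w \<noteq> 0" "M *v w = c *s w" by blast
  have c: "Re c > 0" using assms w unfolding positive_stable_def eigenvalue_def by blast
  have "mat_of (alg_Gamma (cmat M)) *v w = Gamma c *s w"
    using w(3) c by (intro alg_Gamma_eigenvector positive_stable_exp_decaying assms) auto
  then have "Gamma c *s w = 0" using w(1) by (simp add: V_def)
  moreover have "Gamma c \<noteq> 0" using c by (auto simp: Gamma_eq_zero_iff elim!: nonpos_Ints_cases)
  ultimately show False using w(2) by (simp add: vec_eq_iff)
qed

section \<open>Inverses and commutation\<close>

definition cinv :: "'n::finite cmat \<Rightarrow> 'n cmat" where
  "cinv x = cmat (matrix_inv (mat_of x))"

lemma cinv_mult:
  assumes "invertible (mat_of x)"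
  shows "x * cinv x = 1" "cinv x * x = 1"
proof -
  have "mat_of x ** matrix_inv (mat_of x) = mat 1 \<and> matrix_inv (mat_of x) ** mat_of x = mat 1"
    using assms unfolding invertible_def matrix_inv_def by (rule someI_ex)
  then have "mat_of (x * cinv x) = mat_of 1" "mat_of (cinv x * x) = mat_of 1"
    by (simp_all add: cinv_def)
  then show "x * cinv x = 1" "cinv x * x = 1" by (simp_all only: mat_of_inject)
qed

text \<open>
  Any two elements of the bicommutant of a commuting set commute. Closure of the bicommutant under all
  operations involved thus replaces pairwise commutation arguments.
\<close>

definition bicommutant :: "'a::times set \<Rightarrow> 'a set" where
  "bicommutant S = {x. \<forall>q. (\<forall>s\<in>S. s * q = q * s) \<longrightarrow> x * q = q * x}"

lemma bicommutantI:
  "(\<And>q. (\<And>s. s \<in> S \<Longrightarrow> s * q = q * s) \<Longrightarrow> x * q = q * x) \<Longrightarrow> x \<in> bicommutant S"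
  by (simp add: bicommutant_def)

lemma bicommutantD:
  "x \<in> bicommutant S \<Longrightarrow> (\<And>s. s \<in> S \<Longrightarrow> s * q = q * s) \<Longrightarrow> x * q = q * x"
  by (auto simp: bicommutant_def)

text \<open>Since S is commutative, y commutes with all of S, and is therefore one of the elements
  with which x commutes by definition.\<close>

lemma bicommutant_commute:
  assumes "\<And>s t. s \<in> S \<Longrightarrow> t \<in> S \<Longrightarrow> s * t = t * s"
    and "x \<in> bicommutant S" "y \<in> bicommutant S"
  shows "x * y = y * x"
proof (rule bicommutantD[OF assms(2)])
  fix s assume "s \<in> S"
  then have "y * s = s * y" by (intro bicommutantD[OF assms(3)]) (auto intro: assms(1))
  then show "s * y = y * s" by simp
qed

text \<open>With commutation and associativity this allows products to be sorted by ordered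
  rewriting.\<close>

lemma bicommutant_left_commute:
  fixes x y z :: "'a::semigroup_mult"
  assumes "\<And>s t. s \<in> S \<Longrightarrow> t \<in> S \<Longrightarrow> s * t = t * s"
    and "x \<in> bicommutant S" "y \<in> bicommutant S"
  shows "x * (y * z) = y * (x * z)"
  using bicommutant_commute[OF assms] by (metis mult.assoc)

lemma bicommutant_superset: "s \<in> S \<Longrightarrow> s \<in> bicommutant S"
  by (auto simp: bicommutant_def)

lemma bicommutant_1 [simp]: "(1::'a::monoid_mult) \<in> bicommutant S"
  by (auto simp: bicommutant_def)

lemma bicommutant_add [simp]:
  "x \<in> bicommutant S \<Longrightarrow> y \<in> bicommutant S \<Longrightarrow> (x::'a::ring) + y \<in> bicommutant S"
  by (auto simp: bicommutant_def algebra_simps)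

lemma bicommutant_diff [simp]:
  "x \<in> bicommutant S \<Longrightarrow> y \<in> bicommutant S \<Longrightarrow> (x::'a::ring) - y \<in> bicommutant S"
  by (auto simp: bicommutant_def algebra_simps)

lemma bicommutant_scaleR [simp]:
  "x \<in> bicommutant S \<Longrightarrow> r *\<^sub>R (x::'a::real_algebra) \<in> bicommutant S"
  by (auto simp: bicommutant_def)

lemma bicommutant_mult [simp]:
  "x \<in> bicommutant S \<Longrightarrow> y \<in> bicommutant S \<Longrightarrow> (x::'a::ring) * y \<in> bicommutant S"
  unfolding bicommutant_def by (simp add: mult.assoc) (metis mult.assoc)

lemma bicommutant_power [simp]:
  "x \<in> bicommutant S \<Longrightarrow> (x::'a::ring_1) ^ n \<in> bicommutant S"
  by (induction n) simp_all

lemma bicommutant_exp [simp]: "x \<in> bicommutant S \<Longrightarrow> exp x \<in> bicommutant S"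
  by (auto simp: bicommutant_def intro!: exp_commute[symmetric])

lemma bicommutant_rpow [simp]: "x \<in> bicommutant S \<Longrightarrow> rpow t x \<in> bicommutant S"
  by (simp add: rpow_def)

lemma bicommutant_set_integral:
  fixes f :: "real \<Rightarrow> 'a::{real_normed_algebra_1,banach,second_countable_topology}"
  shows "(\<And>t. t \<in> T \<Longrightarrow> f t \<in> bicommutant S) \<Longrightarrow> (LBINT t:T. f t) \<in> bicommutant S"
  by (rule bicommutantI, rule set_integral_mult_commute, rule bicommutantD[where S=S]) blast+

lemma bicommutant_alg_Gamma [simp]: "x \<in> bicommutant S \<Longrightarrow> alg_Gamma x \<in> bicommutant S"
  unfolding alg_Gamma_def by (intro bicommutant_set_integral) simp

lemma bicommutant_alg_Beta [simp]:
  "x \<in> bicommutant S \<Longrightarrow> y \<in> bicommutant S \<Longrightarrow> alg_Beta x y \<in> bicommutant S"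
  unfolding alg_Beta_def by (intro bicommutant_set_integral) simp

lemma bicommutant_cinv [simp]:
  assumes "x \<in> bicommutant S" "invertible (mat_of x)"
  shows "cinv x \<in> bicommutant S"
proof (rule bicommutantI)
  fix q assume "\<And>s. s \<in> S \<Longrightarrow> s * q = q * s"
  then have "x * q = q * x" by (rule bicommutantD[OF assms(1)])
  then have "cinv x * (x * q) * cinv x = cinv x * (q * x) * cinv x" by simp
  then have "(cinv x * x) * (q * cinv x) = (cinv x * q) * (x * cinv x)" by (simp only: mult.assoc)
  then show "cinv x * q = q * cinv x" by (simp add: cinv_mult[OF assms(2)])
qed

section \<open>Pochhammer symbols and gamma values\<close>

definition poch :: "'n::finite cmat \<Rightarrow> nat \<Rightarrow> 'n cmat" where
  "poch x n = cmat (mat_pochhammer (mat_of x) n)"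

lemma mat_of_nat_eq: "(mat (of_nat n) :: complex^'n^'n) = real n *\<^sub>R mat 1"
  by (simp add: vec_eq_iff mat_def complex_eq_iff)

lemma poch_simps [simp]:
  "poch x 0 = 1" "poch x (Suc n) = poch x n * (x + real n *\<^sub>R 1)"
  by (simp_all add: poch_def cmat_simps mat_of_nat_eq)

lemma bicommutant_poch [simp]: "x \<in> bicommutant S \<Longrightarrow> poch x n \<in> bicommutant S"
  by (induction n) simp_all

lemma alg_Gamma_add_nat:
  assumes "exp_decaying M"
  shows "alg_Gamma (M + real n *\<^sub>R 1) = poch M n * alg_Gamma M"
proof (induction n)
  case (Suc n)
  have "alg_Gamma (M + real (Suc n) *\<^sub>R 1) = alg_Gamma ((M + real n *\<^sub>R 1) + 1)"
    by (simp add: algebra_simps)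
  also have "\<dots> = (M + real n *\<^sub>R 1) * alg_Gamma (M + real n *\<^sub>R 1)"
    by (intro alg_Gamma_plus_one exp_decaying_add_scaleR_one assms) simp
  also have "\<dots> = (M + real n *\<^sub>R 1) * poch M n * alg_Gamma M"
    by (simp add: Suc mult.assoc)
  also have "(M + real n *\<^sub>R 1) * poch M n = poch M n * (M + real n *\<^sub>R 1)"
    by (rule bicommutant_commute[of "{M}"]) (simp_all add: bicommutant_superset)
  finally show ?case by simp
qed simp

section \<open>Kummer's function and the Fubini argument\<close>

lemma rpow_power_mult: "u > 0 \<Longrightarrow> u ^ n *\<^sub>R rpow u M = rpow u (M + real n *\<^sub>R 1)"
  using rpow_add_real[of u M "real n"] by (simp add: powr_realpow)

text \<open>For 0 < u < 1 the norm of e^(uW) is at most e^|W|, so the beta majorant still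
  applies.\<close>

lemma set_integrable_exp_Beta:
  fixes M N W :: "'a::{real_normed_algebra_1,banach,second_countable_topology}"
  assumes "exp_decaying M" "exp_decaying N"
  shows "set_integrable lborel {0<..<1} (\<lambda>u. exp (u *\<^sub>R W) * (rpow u (M - 1) * rpow (1 - u) (N - 1)))"
proof -
  have "set_integrable lborel {0<..<1}
      (\<lambda>u. exp (norm W) * (norm (rpow u (M - 1)) * norm (rpow (1 - u) (N - 1))))"
    by (intro set_integrable_mult_right set_integrable_alg_Beta_norm assms)
  then show ?thesis
    unfolding set_integrable_def
  proof (rule Bochner_Integration.integrable_bound, safe intro!: AE_I2)
    fix u :: real
    have "norm (exp (u *\<^sub>R W) * (rpow u (M - 1) * rpow (1 - u) (N - 1))) \<le>
        exp (norm W) * (norm (rpow u (M - 1)) * norm (rpow (1 - u) (N - 1)))" if u: "u \<in> {0<..<1}"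
    proof -
      have "norm (exp (u *\<^sub>R W)) \<le> exp (norm (u *\<^sub>R W))" by (rule norm_exp)
      also have "\<dots> \<le> exp (norm W)" using u by (simp add: mult_left_le_one_le)
      finally show ?thesis
        by (intro order_trans[OF norm_mult_ineq] mult_mono norm_mult_ineq) auto
    qed
    then show "norm (indicator {0<..<1} u *\<^sub>R (exp (u *\<^sub>R W) * (rpow u (M - 1) * rpow (1 - u) (N - 1)))) \<le>
        norm (indicator {0<..<1} u *\<^sub>R (exp (norm W) * (norm (rpow u (M - 1)) * norm (rpow (1 - u) (N - 1)))))"
      by (auto simp: indicator_def)
  qed measurable
qed

text \<open>Termwise integration of the exponential series: u^n raises the exponent M to M + nI, and
  the n-th term is dominated by |W|^n / n! times the beta majorant.\<close>

lemma exp_Beta_sums: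
  fixes M N W :: "'a::{real_normed_algebra_1,banach,second_countable_topology}"
  assumes M: "exp_decaying M" and N: "exp_decaying N"
  shows "(\<lambda>n. (W ^ n /\<^sub>R fact n) * alg_Beta (M + real n *\<^sub>R 1) N) sums
    (LBINT u:{0<..<1}. exp (u *\<^sub>R W) * (rpow u (M - 1) * rpow (1 - u) (N - 1)))"
proof -
  define b where "b u = rpow u (M - 1) * rpow (1 - u) (N - 1)" for u
  define nb where "nb u = norm (rpow u (M - 1)) * norm (rpow (1 - u) (N - 1))" for u
  define h where "h n u = indicator {0<..<1} u *\<^sub>R (((u *\<^sub>R W) ^ n /\<^sub>R fact n) * b u)" for n u
  have h_eq: "h n u = (W ^ n /\<^sub>R fact n) * (indicator {0<..<1} u *\<^sub>R (rpow u (M + real n *\<^sub>R 1 - 1) * rpow (1 - u) (N - 1)))" for n u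
  proof (cases "u \<in> {0<..<1}")
    case True
    have "u ^ n *\<^sub>R b u = rpow u (M + real n *\<^sub>R 1 - 1) * rpow (1 - u) (N - 1)"
      using True rpow_power_mult[of u n "M - 1"] by (simp add: b_def algebra_simps flip: mult_scaleR_left)
    then have "W ^ n * (u ^ n *\<^sub>R b u) = W ^ n * (rpow u (M + real n *\<^sub>R 1 - 1) * rpow (1 - u) (N - 1))"
      by simp
    then show ?thesis using True by (simp add: h_def scaleR_power flip: scaleR_scaleR)
  qed (simp add: h_def)
  have Mn: "exp_decaying (M + real n *\<^sub>R 1)" for n
    by (intro exp_decaying_add_scaleR_one M) simp
  have int_nb: "integrable lborel (\<lambda>u. indicator {0<..<1} u *\<^sub>R nb u)"
    using set_integrable_alg_Beta_norm[OF M N] by (simp add: set_integrable_def nb_def)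
  have int_h: "integrable lborel (h n)" for n
    unfolding h_eq[abs_def]
    using set_integrable_alg_Beta[OF Mn[of n] N] by (intro integrable_mult_right) (simp add: set_integrable_def)
  have integral_h: "integral\<^sup>L lborel (h n) = (W ^ n /\<^sub>R fact n) * alg_Beta (M + real n *\<^sub>R 1) N" for n
    unfolding h_eq[abs_def] alg_Beta_def set_lebesgue_integral_def
    using set_integrable_alg_Beta[OF Mn[of n] N]
    by (subst Bochner_Integration.integral_mult_right) (auto simp: set_integrable_def)
  have norm_h: "norm (h n u) \<le> (norm W ^ n /\<^sub>R fact n) * (indicator {0<..<1} u *\<^sub>R nb u)" for n u
  proof (cases "u \<in> {0<..<1}")
    case True
    have "norm ((u *\<^sub>R W) ^ n) \<le> norm (u *\<^sub>R W) ^ n" by (rule norm_power_ineq)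
    also have "\<dots> \<le> norm W ^ n" using True by (intro power_mono) (auto intro: mult_left_le_one_le)
    finally have "norm ((u *\<^sub>R W) ^ n) \<le> norm W ^ n" .
    then have "norm ((u *\<^sub>R W) ^ n /\<^sub>R fact n) \<le> norm W ^ n /\<^sub>R fact n"
      by (simp add: divide_simps)
    then have "norm (((u *\<^sub>R W) ^ n /\<^sub>R fact n) * b u) \<le> (norm W ^ n /\<^sub>R fact n) * nb u"
      unfolding b_def nb_def by (intro order_trans[OF norm_mult_ineq] mult_mono norm_mult_ineq) auto
    then show ?thesis using True by (simp add: h_def)
  qed (simp add: h_def)
  have summable_W: "summable (\<lambda>n. norm W ^ n /\<^sub>R fact n)" by (rule summable_exp_generic)
  have summable_norm_h: "summable (\<lambda>n. norm (h n u))" for u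
    by (rule summable_comparison_test'[OF summable_mult2[OF summable_W]]) (use norm_h in auto)
  have "(\<lambda>n. integral\<^sup>L lborel (h n)) sums (\<integral>u. (\<Sum>n. h n u) \<partial>lborel)"
  proof (rule sums_integral)
    show "AE u in lborel. summable (\<lambda>n. norm (h n u))" using summable_norm_h by simp
    show "summable (\<lambda>n. \<integral>u. norm (h n u) \<partial>lborel)"
    proof (rule summable_comparison_test'[OF summable_mult2[OF summable_W]])
      fix n
      have "(\<integral>u. norm (h n u) \<partial>lborel) \<le>
          (\<integral>u. (norm W ^ n /\<^sub>R fact n) * (indicator {0<..<1} u *\<^sub>R nb u) \<partial>lborel)"
        using int_h int_nb norm_h by (intro integral_mono integrable_norm integrable_mult_right) auto
      also have "\<dots> = (norm W ^ n /\<^sub>R fact n) * (\<integral>u. indicator {0<..<1} u *\<^sub>R nb u \<partial>lborel)"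
        by (rule integral_mult_right_zero)
      finally show "norm (\<integral>u. norm (h n u) \<partial>lborel) \<le>
          (norm W ^ n /\<^sub>R fact n) * (\<integral>u. indicator {0<..<1} u *\<^sub>R nb u \<partial>lborel)"
        by (simp only: real_norm_def abs_of_nonneg[OF Bochner_Integration.integral_nonneg[OF norm_ge_zero]])
    qed
  qed (rule int_h)
  also have "(\<lambda>u. \<Sum>n. h n u) = (\<lambda>u. indicator {0<..<1} u *\<^sub>R (exp (u *\<^sub>R W) * b u))"
  proof
    fix u
    have "(\<lambda>n. h n u) sums (indicator {0<..<1} u *\<^sub>R (exp (u *\<^sub>R W) * b u))"
      unfolding h_def by (intro sums_scaleR_right sums_mult2 exp_converges)
    then show "(\<Sum>n. h n u) = indicator {0<..<1} u *\<^sub>R (exp (u *\<^sub>R W) * b u)"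
      by (rule sums_unique[symmetric])
  qed
  finally show ?thesis unfolding integral_h set_lebesgue_integral_def b_def .
qed

definition hyp_const :: "'n::finite cmat \<Rightarrow> 'n cmat \<Rightarrow> 'n cmat" where
  "hyp_const A B = alg_Gamma B * cinv (alg_Gamma A) * cinv (alg_Gamma (B - A))"

lemma poch_quotient_eq_Beta:
  fixes A B :: "'n::finite cmat"
  assumes A: "positive_stable (mat_of A)" and B: "positive_stable (mat_of B)"
    and D: "positive_stable (mat_of (B - A))" and comm: "A * B = B * A"
  shows "poch A n * cinv (poch B n) = hyp_const A B * alg_Beta (A + real n *\<^sub>R 1) (B - A)"
proof -
  have dec: "exp_decaying A" "exp_decaying B" "exp_decaying (B - A)"
    using positive_stable_exp_decaying[OF A] positive_stable_exp_decaying[OF B]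
      positive_stable_exp_decaying[OF D] by (simp_all add: cmat_simps)
  have inv: "invertible (mat_of (alg_Gamma A))" "invertible (mat_of (alg_Gamma (B - A)))"
    "invertible (mat_of (poch B n))"
    using invertible_alg_Gamma[OF A] invertible_alg_Gamma[OF D] invertible_mat_pochhammer[OF B]
    by (simp_all add: cmat_simps poch_def)
  define S where "S = {A, B}"
  have S: "s * t = t * s" if "s \<in> S" "t \<in> S" for s t using that comm by (auto simp: S_def)
  have mem [simp]: "A \<in> bicommutant S" "B \<in> bicommutant S"
    by (simp_all add: S_def bicommutant_superset)
  note ac = bicommutant_commute[of S, OF S] bicommutant_left_commute[of S, OF S]
  define a b G iA iD bet where defs: "a = poch A n" "b = poch B n" "G = alg_Gamma B"
    "iA = cinv (alg_Gamma A)" "iD = cinv (alg_Gamma (B - A))" "bet = alg_Beta (A + real n *\<^sub>R 1) (B - A)"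
  have bic: "a \<in> bicommutant S" "b \<in> bicommutant S" "G \<in> bicommutant S" "iA \<in> bicommutant S"
    "iD \<in> bicommutant S" "bet \<in> bicommutant S" "cinv b \<in> bicommutant S"
    by (simp_all add: defs inv)
  have "alg_Gamma (A + real n *\<^sub>R 1) * alg_Gamma (B - A) =
      alg_Gamma (A + real n *\<^sub>R 1 + (B - A)) * bet"
    unfolding defs
    using exp_decaying_add_scaleR_one[OF dec(1), of "real n"] exp_decaying_add_scaleR_one[OF dec(2), of "real n"] dec comm
    by (intro alg_Gamma_mult_Gamma) (auto simp: algebra_simps)
  also have "A + real n *\<^sub>R 1 + (B - A) = B + real n *\<^sub>R 1" by simp
  finally have "a * alg_Gamma A * alg_Gamma (B - A) = b * G * bet"
    by (simp add: alg_Gamma_add_nat dec defs)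
  \<comment> \<open>The inverses are multiplied on in the order that cancels the left side from the
    inside outwards; only the right side has to be rearranged by commutation.\<close>
  then have "(a * alg_Gamma A * alg_Gamma (B - A)) * (iD * iA * cinv b) = (b * G * bet) * (iD * iA * cinv b)"
    by simp
  moreover have "(a * alg_Gamma A * alg_Gamma (B - A)) * (iD * iA * cinv b)
      = a * (alg_Gamma A * (alg_Gamma (B - A) * iD) * iA) * cinv b"
    by (simp only: mult.assoc)
  moreover have "\<dots> = a * cinv b" by (simp add: defs cinv_mult inv)
  moreover have "(b * G * bet) * (iD * iA * cinv b) = (b * cinv b) * (G * iA * iD * bet)"
    by (simp add: mult.assoc ac bic)
  moreover have "b * cinv b = 1" by (simp add: defs cinv_mult inv)
  ultimately show ?thesis by (simp add: hyp_const_def defs)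
qed

lemma mat_1F1_eq_integral:
  fixes A B W :: "'n::finite cmat"
  assumes A: "positive_stable (mat_of A)" and B: "positive_stable (mat_of B)"
    and D: "positive_stable (mat_of (B - A))"
    and comm: "A * B = B * A" "A * W = W * A" "B * W = W * B"
  shows "mat_1F1 (mat_of A) (mat_of B) (mat_of W) = mat_of (hyp_const A B *
    (LBINT u:{0<..<1}. exp (u *\<^sub>R W) * (rpow u (A - 1) * rpow (1 - u) (B - A - 1))))"
proof -
  have dec: "exp_decaying A" "exp_decaying (B - A)"
    using positive_stable_exp_decaying[OF A] positive_stable_exp_decaying[OF D] by (simp_all add: cmat_simps)
  \<comment> \<open>\<open>exp_Beta_sums\<close> has the power of W to the left of the beta value,
    Kummer's series has it to the right of the Pochhammer quotient.\<close>
  have Wbet: "(W ^ n /\<^sub>R fact n) * alg_Beta (A + real n *\<^sub>R 1) (B - A) =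
      alg_Beta (A + real n *\<^sub>R 1) (B - A) * (W ^ n /\<^sub>R fact n)" for n
    by (rule bicommutant_commute[of "{A, B, W}"]) (auto simp: comm bicommutant_superset)
  have "(\<lambda>n. hyp_const A B * ((W ^ n /\<^sub>R fact n) * alg_Beta (A + real n *\<^sub>R 1) (B - A))) sums
    (hyp_const A B * (LBINT u:{0<..<1}. exp (u *\<^sub>R W) * (rpow u (A - 1) * rpow (1 - u) (B - A - 1))))"
    by (intro sums_mult exp_Beta_sums dec)
  also have "(\<lambda>n. hyp_const A B * ((W ^ n /\<^sub>R fact n) * alg_Beta (A + real n *\<^sub>R 1) (B - A))) =
    (\<lambda>n. poch A n * cinv (poch B n) * (W ^ n /\<^sub>R fact n))"
    unfolding Wbet poch_quotient_eq_Beta[OF A B D comm(1)] by (simp only: mult.assoc)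
  finally have "(\<lambda>n. mat_of (poch A n * cinv (poch B n) * (W ^ n /\<^sub>R fact n))) sums
    mat_of (hyp_const A B * (LBINT u:{0<..<1}. exp (u *\<^sub>R W) * (rpow u (A - 1) * rpow (1 - u) (B - A - 1))))"
    by (rule bounded_linear.sums[OF bounded_linear_mat_of])
  moreover have "mat_of (poch A n * cinv (poch B n) * (W ^ n /\<^sub>R fact n)) =
    mat_pochhammer (mat_of A) n ** matrix_inv (mat_pochhammer (mat_of B) n) ** ((1 / fact n) *\<^sub>R mat_power (mat_of W) n)" for n
    by (simp add: poch_def cinv_def mat_of_power divide_inverse scaleR_matrix_mult_right del: poch_simps)
  ultimately show ?thesis unfolding mat_1F1_def by (simp add: sums_iff)
qed

section \<open>Exchange of the two integrations\<close>

definition alg_Gamma_sub :: "'a::{real_normed_algebra_1,banach,second_countable_topology} \<Rightarrow> 'a \<Rightarrow> 'a" where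
  "alg_Gamma_sub Y X = (LBINT t:{0<..}. rpow t (X - 1) * exp (- t *\<^sub>R 1 - (1 / t) *\<^sub>R Y))"

text \<open>Euler's integral for Kummer's function at -tI - Y/t, without the constant
  \<open>hyp_const A B\<close>.\<close>

definition kummer_integral :: "'a::{real_normed_algebra_1,banach,second_countable_topology} \<Rightarrow> 'a \<Rightarrow> 'a \<Rightarrow> real \<Rightarrow> 'a" where
  "kummer_integral A B Y t =
    (LBINT u:{0<..<1}. exp (u *\<^sub>R (- t *\<^sub>R 1 - (1 / t) *\<^sub>R Y)) * (rpow u (A - 1) * rpow (1 - u) (B - A - 1)))"

lemma exp_neg_one_diff: "exp (- t *\<^sub>R 1 - y) = exp (- t) *\<^sub>R exp (- y)"
proof -
  have "- t *\<^sub>R 1 - y = - y + (- t) *\<^sub>R 1" by simp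
  then show ?thesis by (simp only: exp_add_scaleR_one)
qed

lemma exp_decaying_bounded:
  assumes "exp_decaying Y"
  obtains C where "C \<ge> 0" "\<And>r. r \<ge> 0 \<Longrightarrow> norm (exp (- (r *\<^sub>R Y))) \<le> C"
proof -
  obtain C \<alpha> where \<alpha>: "\<alpha> > 0"
    and C: "\<And>s. s \<ge> 0 \<Longrightarrow> norm (exp (- (s *\<^sub>R Y))) \<le> C * exp (- (\<alpha> * s))"
    using assms unfolding exp_decaying_def by blast
  have C0: "C \<ge> 0" using order_trans[OF norm_ge_zero C[of 0]] by simp
  have "norm (exp (- (r *\<^sub>R Y))) \<le> C" if "r \<ge> 0" for r
    using C[OF that] \<alpha> that C0 by (smt (verit) exp_le_one_iff mult_left_le mult_nonneg_nonneg)
  with C0 show ?thesis by (rule that)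
qed

text \<open>In the variables u and s = ut the integrand is a function of s times a function of u,
  except for exp(-(u^2/s)Y). Decay of Y bounds that factor by a constant C, so a product of two
  integrable functions is a majorant.\<close>

lemma Fubini_kummer_Gamma_sub:
  fixes A B X Y :: "'a::{real_normed_algebra_1,banach,second_countable_topology}"
  assumes D: "exp_decaying (B - A)" and A: "exp_decaying A" and X: "exp_decaying X" and Y: "exp_decaying Y"
    and AX: "exp_decaying (A - X)"
    and comm: "A * B = B * A" "A * X = X * A" "A * Y = Y * A" "B * X = X * B" "B * Y = Y * B" "X * Y = Y * X"
  defines "f \<equiv> \<lambda>t. kummer_integral A B Y t * rpow t (X - 1)"
    and "g \<equiv> \<lambda>\<mu>. alg_Gamma_sub (\<mu>\<^sup>2 *\<^sub>R Y) X * rpow \<mu> (A - X - 1) * rpow (1 - \<mu>) (B - A - 1)"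
  shows "set_integrable lborel {0<..} f" "set_integrable lborel {0<..<1} g"
    "(LBINT t:{0<..}. f t) = (LBINT \<mu>:{0<..<1}. g \<mu>)"
proof -
  define S where "S = {A, B, X, Y}"
  have S: "s * t = t * s" if "s \<in> S" "t \<in> S" for s t using that comm by (auto simp: S_def)
  have mem [simp]: "A \<in> bicommutant S" "B \<in> bicommutant S" "X \<in> bicommutant S" "Y \<in> bicommutant S"
    by (simp_all add: S_def bicommutant_superset)
  note ac = bicommutant_commute[of S, OF S] bicommutant_left_commute[of S, OF S]
  obtain C where C: "C \<ge> 0" "\<And>r. r \<ge> 0 \<Longrightarrow> norm (exp (- (r *\<^sub>R Y))) \<le> C"
    by (rule exp_decaying_bounded[OF Y]) (rule that, assumption+)
  define e where "e s = indicator {0<..} s *\<^sub>R exp (- s) *\<^sub>R rpow s (X - 1)" for s :: real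
  define b where "b u = indicator {0<..<1} u *\<^sub>R (rpow u (A - X - 1) * rpow (1 - u) (B - A - 1))" for u :: real
  define nb where "nb u = indicator {0<..<1} u *\<^sub>R (norm (rpow u (A - X - 1)) * norm (rpow (1 - u) (B - A - 1)))" for u :: real
  define H where "H u s = e s * exp (- ((u\<^sup>2 / s) *\<^sub>R Y)) * b u" for u s
  have [measurable]: "e \<in> borel_measurable borel" "b \<in> borel_measurable borel" "nb \<in> borel_measurable borel"
    unfolding e_def b_def nb_def by measurable
  have int_e: "integrable lborel e"
    using set_integrable_alg_Gamma[OF X] by (simp add: set_integrable_def e_def[abs_def])
  have int_nb: "integrable lborel nb"
    using set_integrable_alg_Beta_norm[OF AX D] by (simp add: set_integrable_def nb_def[abs_def])
  have nb: "norm (b u) \<le> nb u" for u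
    by (auto simp: b_def nb_def indicator_def norm_mult_ineq)
  have int_H: "integrable (lborel \<Otimes>\<^sub>M lborel) (\<lambda>(u, s). H u s)"
  proof (rule Bochner_Integration.integrable_bound[OF integrable_pair_times[OF int_nb integrable_mult_right[OF integrable_norm[OF int_e], of C]]])
    show "(\<lambda>(u, s). H u s) \<in> borel_measurable (lborel \<Otimes>\<^sub>M lborel)"
      unfolding H_def by measurable
    have "norm (H u s) \<le> norm (nb u * (C * norm (e s)))" for u s
    \<comment> \<open>The bound C holds for nonnegative multiples of Y; for s \<le> 0 the factor
      \<open>e s\<close> vanishes.\<close>
    proof (cases "s > 0")
      case True
      have "norm (H u s) \<le> norm (e s) * norm (exp (- ((u\<^sup>2 / s) *\<^sub>R Y))) * norm (b u)"
        unfolding H_def by (intro order_trans[OF norm_mult_ineq] mult_right_mono norm_mult_ineq) auto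
      also have "\<dots> \<le> norm (e s) * C * nb u"
        using True C by (intro mult_mono nb) auto
      also have "\<dots> \<le> norm (nb u * (C * norm (e s)))" by (simp add: mult_ac)
      finally show ?thesis .
    qed (simp add: H_def e_def)
    then show "AE p in lborel \<Otimes>\<^sub>M lborel. norm (case p of (u, s) \<Rightarrow> H u s) \<le> norm (case p of (u, s) \<Rightarrow> nb u * (C * norm (e s)))"
      by auto
  qed
  \<comment> \<open>The double integrand in the original variables u and t; the factor |u| is the
    Jacobian of s = ut.\<close>
  define G where "G u t = \<bar>u\<bar> *\<^sub>R H u (u * t)" for u t
  have int_G: "integrable (lborel \<Otimes>\<^sub>M lborel) (\<lambda>(u, t). G u t)"
    using integrable_pair_affine[OF int_H, of "\<lambda>u. u" "\<lambda>_. 0"] AE_lborel_singleton[of 0] by (simp add: G_def)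
  have inner_G: "(\<integral>u. G u t \<partial>lborel) = indicator {0<..} t *\<^sub>R f t" for t
  proof (cases "t > 0")
    case True
    have G_eq: "G u t = (indicator {0<..<1} u *\<^sub>R (exp (u *\<^sub>R (- t *\<^sub>R 1 - (1 / t) *\<^sub>R Y)) * (rpow u (A - 1) * rpow (1 - u) (B - A - 1)))) * rpow t (X - 1)" for u
    proof (cases "u \<in> {0<..<1}")
      case u: True
      have 1: "exp (u *\<^sub>R (- t *\<^sub>R 1 - (1 / t) *\<^sub>R Y)) = exp (- (u * t)) *\<^sub>R exp (- ((u / t) *\<^sub>R Y))"
        using exp_neg_one_diff[of "u * t" "(u / t) *\<^sub>R Y"] by (simp add: algebra_simps)
      have 2: "rpow u (A - 1) = u *\<^sub>R (rpow u (X - 1) * rpow u (A - X - 1))"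
      proof -
        have "rpow u (X - 1) * rpow u (A - X - 1) = rpow u ((X - 1) + (A - X - 1))"
          using comm by (intro rpow_add[symmetric]) (simp add: algebra_simps)
        also have "(X - 1) + (A - X - 1) = (A - 1) - 1" by simp
        finally show ?thesis using u by (simp add: rpow_diff_one[of u "A - 1"])
      qed
      have 3: "rpow (u * t) (X - 1) = rpow u (X - 1) * rpow t (X - 1)" using u True by (intro rpow_mult) auto
      have 4: "u\<^sup>2 / (u * t) = u / t" using u by (simp add: power2_eq_square)
      have "G u t = (u * exp (- (u * t))) *\<^sub>R (rpow u (X - 1) * rpow t (X - 1) * exp (- ((u / t) *\<^sub>R Y)) * (rpow u (A - X - 1) * rpow (1 - u) (B - A - 1)))"
        using u True by (simp add: G_def H_def e_def b_def 3 4)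
      also have "rpow u (X - 1) * rpow t (X - 1) * exp (- ((u / t) *\<^sub>R Y)) * (rpow u (A - X - 1) * rpow (1 - u) (B - A - 1))
        = exp (- ((u / t) *\<^sub>R Y)) * (rpow u (X - 1) * rpow u (A - X - 1) * rpow (1 - u) (B - A - 1)) * rpow t (X - 1)"
        by (simp add: mult.assoc ac flip: scaleR_minus_left)
      finally show ?thesis using u unfolding 1 2 by (simp add: mult.assoc mult.commute[of u])
    qed (simp add: G_def H_def b_def)
    have "set_integrable lborel {0<..<1} (\<lambda>u. exp (u *\<^sub>R (- t *\<^sub>R 1 - (1 / t) *\<^sub>R Y)) * (rpow u (A - 1) * rpow (1 - u) (B - A - 1)))"
      by (intro set_integrable_exp_Beta A D)
    then show ?thesis
      unfolding G_eq f_def kummer_integral_def set_lebesgue_integral_def set_integrable_def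
      using True by (subst Bochner_Integration.integral_mult_left) auto
  next
    case False
    have "G u t = 0" for u
    proof (cases "u > 0")
      case True
      then have "\<not> u * t > 0" using False by (simp add: zero_less_mult_iff)
      then show ?thesis by (simp add: G_def H_def e_def)
    qed (simp add: G_def H_def b_def)
    then show ?thesis using False by simp
  qed
  have inner_H: "(\<integral>s. H u s \<partial>lborel) = indicator {0<..<1} u *\<^sub>R g u" for u
  proof -
    have int: "integrable lborel (\<lambda>s. e s * exp (- ((u\<^sup>2 / s) *\<^sub>R Y)))"
    proof (rule Bochner_Integration.integrable_bound[OF integrable_mult_right[OF integrable_norm[OF int_e], of C]])
      have "norm (e s * exp (- ((u\<^sup>2 / s) *\<^sub>R Y))) \<le> norm (C * norm (e s))" for s
      proof (cases "s > 0")
        case True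
        have "norm (e s * exp (- ((u\<^sup>2 / s) *\<^sub>R Y))) \<le> norm (e s) * norm (exp (- ((u\<^sup>2 / s) *\<^sub>R Y)))"
          by (rule norm_mult_ineq)
        also have "\<dots> \<le> norm (e s) * C" using True by (intro mult_left_mono C(2)) auto
        finally show ?thesis using C(1) by (simp add: mult.commute)
      qed (simp add: e_def)
      then show "AE s in lborel. norm (e s * exp (- ((u\<^sup>2 / s) *\<^sub>R Y))) \<le> norm (C * norm (e s))" by simp
    qed measurable
    have "(\<lambda>s. e s * exp (- ((u\<^sup>2 / s) *\<^sub>R Y))) = (\<lambda>s. indicator {0<..} s *\<^sub>R (rpow s (X - 1) * exp (- s *\<^sub>R 1 - (1 / s) *\<^sub>R u\<^sup>2 *\<^sub>R Y)))"
      by (rule ext) (auto simp: e_def exp_neg_one_diff indicator_def simp del: scaleR_minus_left)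
    then have "(\<integral>s. e s * exp (- ((u\<^sup>2 / s) *\<^sub>R Y)) \<partial>lborel) = alg_Gamma_sub (u\<^sup>2 *\<^sub>R Y) X"
      by (simp add: alg_Gamma_sub_def set_lebesgue_integral_def)
    then show ?thesis
      unfolding H_def using int
      by (subst Bochner_Integration.integral_mult_left) (auto simp: g_def b_def mult.assoc)
  qed
  \<comment> \<open>Fubini also gives the integrability of the partial integrals, which are f and g
    cut off by their indicators.\<close>
  show "set_integrable lborel {0<..} f"
    using lborel_pair.integrable_snd[OF int_G] unfolding inner_G set_integrable_def .
  show "set_integrable lborel {0<..<1} g"
    using lborel_pair.integrable_fst[OF int_H] unfolding inner_H set_integrable_def .
  have "(LBINT t:{0<..}. f t) = (\<integral>t. (\<integral>u. G u t \<partial>lborel) \<partial>lborel)"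
    by (simp add: inner_G set_lebesgue_integral_def)
  also have "\<dots> = (\<integral>u. (\<integral>t. G u t \<partial>lborel) \<partial>lborel)"
    by (rule lborel_pair.Fubini_integral[OF int_G])
  also have "\<dots> = (\<integral>u. (\<integral>s. H u s \<partial>lborel) \<partial>lborel)"
  proof (rule Bochner_Integration.integral_cong[OF refl])
    fix u
    show "(\<integral>t. G u t \<partial>lborel) = (\<integral>s. H u s \<partial>lborel)"
    \<comment> \<open>The substitution degenerates at u = 0, but there the indicator in b makes both
      sides 0.\<close>
    proof (cases "u = 0")
      case True
      then show ?thesis by (simp add: G_def H_def b_def)
    next
      case False
      then show ?thesis
        using lborel_integral_real_affine[of u "H u" 0] by (simp add: G_def)
    qed
  qed
  also have "\<dots> = (LBINT \<mu>:{0<..<1}. g \<mu>)"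
    by (simp add: inner_H set_lebesgue_integral_def)
  finally show "(LBINT t:{0<..}. f t) = (LBINT \<mu>:{0<..<1}. g \<mu>)" .
qed

section \<open>Asymptotics and failure of integrability\<close>

text \<open>As ln is unbounded at 0 and at infinity, suitable a and b contradict every finite value
  of the integral when S reaches one of these ends.\<close>

lemma ln_diff_le_set_integral_inverse:
  assumes int: "set_integrable lborel S (\<lambda>x. 1 / x)" and S: "{a..b} \<subseteq> S" "S \<subseteq> {0<..}"
    and ab: "0 < a" "a \<le> b"
  shows "ln b - ln a \<le> (LBINT x:S. 1 / x :: real)"
proof -
  have "(\<integral>x. indicator {a..b} x *\<^sub>R (1 / x) \<partial>lborel) = ln b - ln a"
    using ab
    by (intro integral_FTC_atLeastAtMost)
      (auto intro!: continuous_intros derivative_eq_intros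
        simp flip: has_real_derivative_iff_has_vector_derivative)
  moreover have "(\<integral>x. indicator {a..b} x *\<^sub>R (1 / x) \<partial>lborel) \<le> (\<integral>x. indicator S x *\<^sub>R (1 / x) \<partial>lborel)"
  proof (rule integral_mono)
    show "integrable lborel (\<lambda>x. indicator S x *\<^sub>R (1 / x))"
      using int by (simp add: set_integrable_def)
    show "integrable lborel (\<lambda>x. indicator {a..b} x *\<^sub>R (1 / x))"
      using set_integrable_subset[OF int _ S(1)] by (simp add: set_integrable_def)
    show "indicator {a..b} x *\<^sub>R (1 / x) \<le> indicator S x *\<^sub>R (1 / x)" for x :: real
      using S by (auto simp: indicator_def)
  qed
  ultimately show ?thesis by (simp add: set_lebesgue_integral_def)
qed

text \<open>The function |f|/\<delta> is an integrable majorant of 1/x on T.\<close>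

lemma set_integrable_inverse_of_lower_bound:
  fixes f :: "real \<Rightarrow> 'a::{banach,second_countable_topology}"
  assumes f: "set_integrable lborel S f" and T: "T \<subseteq> S" "T \<subseteq> {0<..}" "T \<in> sets borel" and "\<delta> > 0"
    and le: "\<And>x. x \<in> T \<Longrightarrow> \<delta> / x \<le> norm (f x)"
  shows "set_integrable lborel T (\<lambda>x. 1 / x :: real)"
proof -
  have "set_integrable lborel T f" using set_integrable_subset[OF f _ T(1)] T(3) by simp
  then have "integrable lborel (\<lambda>x. 1 / \<delta> * norm (indicator T x *\<^sub>R f x))"
    unfolding set_integrable_def by (intro integrable_mult_right integrable_norm)
  then show ?thesis
    unfolding set_integrable_def
  proof (rule Bochner_Integration.integrable_bound, safe intro!: AE_I2)
    fix x
    show "norm (indicator T x *\<^sub>R (1 / x)) \<le> norm (1 / \<delta> * norm (indicator T x *\<^sub>R f x))"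
    proof (cases "x \<in> T")
      case True
      then have "x > 0" using T(2) by auto
      then show ?thesis using le[OF True] True \<open>\<delta> > 0\<close> by (simp add: field_simps)
    qed simp
  qed (use T(3) in measurable)
qed

lemma not_set_integrable_lower_bound_at_top:
  fixes f :: "real \<Rightarrow> 'a::{banach,second_countable_topology}"
  assumes "\<delta> > 0" "T > 0" and le: "\<And>x. x > T \<Longrightarrow> \<delta> / x \<le> norm (f x)"
  shows "\<not> set_integrable lborel {0<..} f"
proof
  assume "set_integrable lborel {0<..} f"
  then have int: "set_integrable lborel {T<..} (\<lambda>x. 1 / x :: real)"
    using assms by (rule_tac set_integrable_inverse_of_lower_bound) auto
  define I where "I = (LBINT x:{T<..}. 1 / x :: real)"
  define a where "a = T + 1"
  \<comment> \<open>Chosen so that ln b - ln a = |I| + 1, which exceeds I.\<close>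
  define b where "b = a * exp (\<bar>I\<bar> + 1)"
  have "a > 0" "a \<le> b" using \<open>T > 0\<close> by (auto simp: a_def b_def)
  then have "ln b - ln a \<le> I"
    unfolding I_def using \<open>T > 0\<close> by (intro ln_diff_le_set_integral_inverse int) (auto simp: a_def)
  moreover have "ln b = ln a + (\<bar>I\<bar> + 1)" using \<open>a > 0\<close> by (simp add: b_def ln_mult)
  ultimately show False by simp
qed

lemma not_set_integrable_lower_bound_at_0:
  fixes f :: "real \<Rightarrow> 'a::{banach,second_countable_topology}"
  assumes "\<delta> > 0" "0 < \<epsilon>" "\<epsilon> \<le> 1" and le: "\<And>x. 0 < x \<Longrightarrow> x < \<epsilon> \<Longrightarrow> \<delta> / x \<le> norm (f x)"
  shows "\<not> set_integrable lborel {0<..<1} f"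
proof
  assume "set_integrable lborel {0<..<1} f"
  then have int: "set_integrable lborel {0<..<\<epsilon>} (\<lambda>x. 1 / x :: real)"
    using assms by (rule_tac set_integrable_inverse_of_lower_bound) auto
  define I where "I = (LBINT x:{0<..<\<epsilon>}. 1 / x :: real)"
  define b where "b = \<epsilon> / 2"
  \<comment> \<open>Again ln b - ln a = |I| + 1, now with the left end moved towards 0.\<close>
  define a where "a = b * exp (- (\<bar>I\<bar> + 1))"
  have "a > 0" "a \<le> b" "b > 0" using \<open>\<epsilon> > 0\<close> by (auto simp: a_def b_def)
  then have "ln b - ln a \<le> I"
    unfolding I_def using \<open>\<epsilon> > 0\<close> by (intro ln_diff_le_set_integral_inverse int) (auto simp: b_def)
  moreover have "ln a = ln b - (\<bar>I\<bar> + 1)" using \<open>b > 0\<close> by (simp add: a_def ln_mult)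
  ultimately show False by simp
qed

section \<open>Limits of the two inner integrals\<close>

lemma norm_rpow_complex: "t > 0 \<Longrightarrow> norm (rpow t (c::complex)) = t powr Re c"
  by (simp add: rpow_def powr_def mult.commute)

lemma tendsto_rpow_1:
  assumes "(f \<longlongrightarrow> 1) F"
  shows "((\<lambda>x. rpow (f x) M) \<longlongrightarrow> 1) F"
proof -
  have "((\<lambda>x. exp (ln (f x) *\<^sub>R M)) \<longlongrightarrow> exp (ln 1 *\<^sub>R M)) F"
    by (intro tendsto_exp_algebra tendsto_scaleR tendsto_ln assms tendsto_const) simp
  then show ?thesis by (simp add: rpow_def)
qed

text \<open>Away from u = 1 the power is harmless: (1-u)^(\<alpha>-1) is at most 1/(1-u), which is
  below 2.\<close>

lemma norm_rpow_one_minus_le: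
  assumes "exp_decaying M"
  obtains C where "C \<ge> 0" "\<And>u. 0 < u \<Longrightarrow> u < 1/2 \<Longrightarrow> norm (rpow (1 - u) (M - 1)) \<le> C"
proof -
  obtain C \<alpha> where C: "\<alpha> > 0" "C \<ge> 0"
    "\<And>t. 0 < t \<Longrightarrow> t \<le> 1 \<Longrightarrow> norm (rpow t (M - 1)) \<le> C * t powr (\<alpha> - 1)"
    by (rule norm_rpow_le_of_decaying[OF assms]) (rule that, assumption+)
  have "norm (rpow (1 - u) (M - 1)) \<le> C * 2" if u: "0 < u" "u < 1/2" for u
  proof -
    have "(1 - u) powr (\<alpha> - 1) = (1 - u) powr \<alpha> / (1 - u)" using u by (simp add: powr_diff)
    also have "\<dots> \<le> 1 / (1/2)" using u C(1) by (intro frac_le powr_le1) auto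
    finally have "C * (1 - u) powr (\<alpha> - 1) \<le> C * 2" using C(2) by (intro mult_left_mono) auto
    then show ?thesis using C(3)[of "1 - u"] u by simp
  qed
  then show ?thesis using C(2) by (intro that[of "C * 2"]) auto
qed

text \<open>Dominated convergence: exp(-(\<mu>^2/s)Y) stays bounded by C and tends to I as \<mu>
  \<rightarrow> 0. The parameter is written \<mu> = 1/t because
  \<open>integral_dominated_convergence_at_top\<close> takes limits at infinity.\<close>

lemma tendsto_alg_Gamma_sub:
  fixes X Y :: "'a::{real_normed_algebra_1,banach,second_countable_topology}"
  assumes X: "exp_decaying X" and Y: "exp_decaying Y"
  shows "((\<lambda>t. alg_Gamma_sub ((1 / t)\<^sup>2 *\<^sub>R Y) X) \<longlongrightarrow> alg_Gamma X) at_top"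
proof -
  obtain C where C: "C \<ge> 0" "\<And>r. r \<ge> 0 \<Longrightarrow> norm (exp (- (r *\<^sub>R Y))) \<le> C"
    by (rule exp_decaying_bounded[OF Y]) (rule that, assumption+)
  define e where "e s = indicator {0<..} s *\<^sub>R exp (- s) *\<^sub>R rpow s (X - 1)" for s :: real
  have int_e: "integrable lborel e"
    using set_integrable_alg_Gamma[OF X] by (simp add: set_integrable_def e_def[abs_def])
  note [measurable] = borel_measurable_integrable[OF int_e]
  have "((\<lambda>t. \<integral>s. e s * exp (- (((1 / t)\<^sup>2 / s) *\<^sub>R Y)) \<partial>lborel) \<longlongrightarrow> (\<integral>s. e s \<partial>lborel)) at_top"
  proof (rule integral_dominated_convergence_at_top[where w="\<lambda>s. C * norm (e s)"])
    show "integrable lborel (\<lambda>s. C * norm (e s))" using int_e by simp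
    have "((\<lambda>t. e s * exp (- (((1 / t)\<^sup>2 / s) *\<^sub>R Y))) \<longlongrightarrow> e s) at_top" for s
    proof -
      have "((\<lambda>t::real. 1 / t) \<longlongrightarrow> 0) at_top"
        by (rule tendsto_divide_0[OF tendsto_const filterlim_at_top_imp_at_infinity[OF filterlim_ident]])
      then have "((\<lambda>t. e s * exp (- (((1 / t)\<^sup>2 / s) *\<^sub>R Y))) \<longlongrightarrow> e s * exp (- ((0\<^sup>2 * inverse s) *\<^sub>R Y))) at_top"
        unfolding divide_inverse[of _ s]
        by (intro tendsto_mult tendsto_const tendsto_exp_algebra tendsto_minus tendsto_scaleR tendsto_power)
      then show ?thesis by simp
    qed
    then show "AE s in lborel. ((\<lambda>t. e s * exp (- (((1 / t)\<^sup>2 / s) *\<^sub>R Y))) \<longlongrightarrow> e s) at_top" by simp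
    have "norm (e s * exp (- (((1 / t)\<^sup>2 / s) *\<^sub>R Y))) \<le> C * norm (e s)" for s t
    proof (cases "s > 0")
      case True
      have "norm (e s * exp (- (((1 / t)\<^sup>2 / s) *\<^sub>R Y))) \<le> norm (e s) * norm (exp (- (((1 / t)\<^sup>2 / s) *\<^sub>R Y)))"
        by (rule norm_mult_ineq)
      also have "\<dots> \<le> norm (e s) * C" using True by (intro mult_left_mono C(2)) auto
      finally show ?thesis by (simp add: mult.commute)
    qed (simp add: e_def)
    then show "\<forall>\<^sub>F t in at_top. AE s in lborel. norm (e s * exp (- (((1 / t)\<^sup>2 / s) *\<^sub>R Y))) \<le> C * norm (e s)"
      by simp
  qed measurable
  moreover have "(\<integral>s. e s * exp (- (((1 / t)\<^sup>2 / s) *\<^sub>R Y)) \<partial>lborel) = alg_Gamma_sub ((1 / t)\<^sup>2 *\<^sub>R Y) X" for t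
    unfolding alg_Gamma_sub_def set_lebesgue_integral_def
    by (rule Bochner_Integration.integral_cong)
      (auto simp: e_def exp_neg_one_diff indicator_def simp del: scaleR_minus_left)
  ultimately show ?thesis
    by (simp add: alg_Gamma_def set_lebesgue_integral_def e_def[abs_def])
qed

text \<open>A matrix form of Watson's lemma. The mass sits at u of order 1/t; with s = ut, t^A
  u^(A-I) du becomes s^(A-I) ds, while exp(-(u/t)Y) and (1-u)^(B-A-I) tend to I.\<close>

lemma tendsto_rpow_kummer_integral:
  fixes A B Y :: "'a::{real_normed_algebra_1,banach,second_countable_topology}"
  assumes A: "exp_decaying A" and D: "exp_decaying (B - A)" and Y: "exp_decaying Y"
    and comm: "A * B = B * A" "A * Y = Y * A" "B * Y = Y * B"
  shows "((\<lambda>t. rpow t A * kummer_integral A B Y t) \<longlongrightarrow> alg_Gamma A) at_top"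
proof -
  obtain C where C: "C \<ge> 0" "\<And>r. r \<ge> 0 \<Longrightarrow> norm (exp (- (r *\<^sub>R Y))) \<le> C"
    by (rule exp_decaying_bounded[OF Y]) (rule that, assumption+)
  obtain K where K: "K \<ge> 0" "\<And>u. 0 < u \<Longrightarrow> u < 1/2 \<Longrightarrow> norm (rpow (1 - u) (B - A - 1)) \<le> K"
    by (rule norm_rpow_one_minus_le[OF D]) (rule that, assumption+)
  define q where "q t u = exp (u *\<^sub>R (- t *\<^sub>R 1 - (1 / t) *\<^sub>R Y)) * (rpow u (A - 1) * rpow (1 - u) (B - A - 1))" for t u :: real
  have q_eq: "q t u = exp (- (u * t)) *\<^sub>R (exp (- ((u / t) *\<^sub>R Y)) * (rpow u (A - 1) * rpow (1 - u) (B - A - 1)))" for t u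
    using exp_neg_one_diff[of "u * t" "(u / t) *\<^sub>R Y"] by (simp add: q_def algebra_simps)
  have int_q: "set_integrable lborel {0<..<1} (q t)" for t
    unfolding q_def by (intro set_integrable_exp_Beta A D)
  have int1: "set_integrable lborel {0<..<1/2} (q t)" for t
    by (rule set_integrable_subset[OF int_q]) auto
  have int2: "set_integrable lborel {1/2..<1} (q t)" for t
    by (rule set_integrable_subset[OF int_q]) auto
  define nb where "nb u = norm (rpow u (A - 1)) * norm (rpow (1 - u) (B - A - 1))" for u
  have int_nb: "set_integrable lborel {1/2..<1} nb"
    unfolding nb_def by (rule set_integrable_subset[OF set_integrable_alg_Beta_norm[OF A D]]) auto
  txt \<open>The singularity of $(1-u)^{B-A-I}$ at $u = 1$ has no integrable majorant after the
    substitution $s = ut$, but the part $u \ge 1/2$ is exponentially small.\<close>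
  have split: "kummer_integral A B Y t = (LBINT u:{0<..<1/2}. q t u) + (LBINT u:{1/2..<1}. q t u)" for t
  proof -
    have "{0<..<1} = {0<..<1/2} \<union> {1/2..<1::real}" by auto
    then show ?thesis
      unfolding kummer_integral_def q_def[symmetric]
      by (simp only:) (intro set_integral_Un int1 int2, auto)
  qed
  have tail: "((\<lambda>t. rpow t A * (LBINT u:{1/2..<1}. q t u)) \<longlongrightarrow> 0) at_top"
  proof -
    define I where "I = (LBINT u:{1/2..<1}. nb u)"
    have bound: "norm (LBINT u:{1/2..<1}. q t u) \<le> exp (- (t / 2)) * (C * I)" if t: "t > 0" for t
    proof -
      have qb: "norm (q t u) \<le> exp (- (t / 2)) * (C * nb u)" if u: "u \<in> {1/2..<1}" for u
      proof -
        have "norm (exp (- ((u / t) *\<^sub>R Y)) * (rpow u (A - 1) * rpow (1 - u) (B - A - 1))) \<le> C * nb u"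
          unfolding nb_def using u t C
          by (intro order_trans[OF norm_mult_ineq] mult_mono norm_mult_ineq C(2)) auto
        moreover have "exp (- (u * t)) \<le> exp (- (t / 2))" using u t by simp
        ultimately show ?thesis
          unfolding q_eq norm_scaleR by (intro mult_mono) auto
      qed
      have le: "norm (indicator {1/2..<1} u *\<^sub>R q t u) \<le>
          exp (- (t / 2)) * (C * (indicator {1/2..<1} u *\<^sub>R nb u))" for u
        using qb[of u] by (cases "u \<in> {1/2..<1}") simp_all
      have int: "integrable lborel (\<lambda>u. exp (- (t / 2)) * (C * (indicator {1/2..<1} u *\<^sub>R nb u)))"
        by (rule integrable_mult_right, rule integrable_mult_right)
          (rule int_nb[unfolded set_integrable_def])
      have "norm (LBINT u:{1/2..<1}. q t u) \<le> (\<integral>u. exp (- (t / 2)) * (C * (indicator {1/2..<1} u *\<^sub>R nb u)) \<partial>lborel)"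
        unfolding set_lebesgue_integral_def
        by (rule Bochner_Integration.integral_norm_bound_integral[OF int2[unfolded set_integrable_def] int])
          (rule le)
      also have "\<dots> = exp (- (t / 2)) * (C * I)"
        by (simp only: integral_mult_right_zero I_def set_lebesgue_integral_def)
      finally show ?thesis .
    qed
    \<comment> \<open>Writing t^A = 2^A (t/2)^A pairs the power with e^(-t/2), so that
      \<open>tendsto_exp_rpow_at_top\<close> applies at t/2.\<close>
    have "eventually (\<lambda>t. norm (rpow t A * (LBINT u:{1/2..<1}. q t u)) \<le>
        norm (rpow 2 A * (exp (- (t / 2)) *\<^sub>R rpow (t / 2) A)) * (C * I)) at_top"
      using eventually_gt_at_top[of 0]
    proof eventually_elim
      case (elim t)
      have "rpow t A = rpow 2 A * rpow (t / 2) A" using rpow_mult[of 2 "t / 2" A] elim by simp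
      then have "norm (rpow 2 A * (exp (- (t / 2)) *\<^sub>R rpow (t / 2) A)) = norm (rpow t A) * exp (- (t / 2))"
        by simp
      moreover have "norm (rpow t A * (LBINT u:{1/2..<1}. q t u)) \<le> norm (rpow t A) * (exp (- (t / 2)) * (C * I))"
        by (intro order_trans[OF norm_mult_ineq] mult_left_mono bound elim) auto
      ultimately show ?case by (simp add: mult_ac)
    qed
    moreover have "((\<lambda>t. norm (rpow 2 A * (exp (- (t / 2)) *\<^sub>R rpow (t / 2) A)) * (C * I)) \<longlongrightarrow> norm (rpow 2 A * 0) * (C * I)) at_top"
    proof (intro tendsto_mult tendsto_norm tendsto_const)
      have "filterlim (\<lambda>t::real. t / 2) at_top at_top"
        by (rule filterlim_at_top_mult_tendsto_pos[where c="1/2", of "\<lambda>_. 1/2" _ "\<lambda>t. t", simplified]) (auto simp: filterlim_ident)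
      from filterlim_compose[OF tendsto_exp_rpow_at_top this]
      show "((\<lambda>t. exp (- (t / 2)) *\<^sub>R rpow (t / 2) A) \<longlongrightarrow> 0) at_top" .
    qed
    ultimately show ?thesis by (simp add: Lim_null_comparison)
  qed
  define e where "e s = indicator {0<..} s *\<^sub>R exp (- s) *\<^sub>R rpow s (A - 1)" for s :: real
  have int_e: "integrable lborel e"
    using set_integrable_alg_Gamma[OF A] by (simp add: set_integrable_def e_def[abs_def])
  note [measurable] = borel_measurable_integrable[OF int_e]
  \<comment> \<open>The integrand after s = ut, extended by 0 beyond s = t/2 so that the domain no
    longer depends on t.\<close>
  define k where "k t s = indicator {0<..<t/2} s *\<^sub>R (e s * exp (- ((s / t\<^sup>2) *\<^sub>R Y)) * rpow (1 - s / t) (B - A - 1))" for t s :: real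
  have main: "rpow t A * (LBINT u:{0<..<1/2}. q t u) = (\<integral>s. k t s \<partial>lborel)" if t: "t > 0" for t
  proof -
    define S where "S = {A, B, Y}"
    have S: "s * t = t * s" if "s \<in> S" "t \<in> S" for s t using that comm by (auto simp: S_def)
    have mem [simp]: "A \<in> bicommutant S" "B \<in> bicommutant S" "Y \<in> bicommutant S"
      by (simp_all add: S_def bicommutant_superset)
    note ac = bicommutant_commute[of S, OF S] bicommutant_left_commute[of S, OF S]
    have eq: "(1 / t) *\<^sub>R (rpow t A * (indicator {0<..<1/2} (s / t) *\<^sub>R q t (s / t))) = k t s" for s
    proof (cases "0 < s \<and> s < t / 2")
      case True
      have 1: "(1 / t) *\<^sub>R (rpow t A * rpow (s / t) (A - 1)) = rpow s (A - 1)"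
        using rpow_mult[of t "s / t" "A - 1"] True t by (simp add: rpow_diff_one[of t A])
      have "(1 / t) *\<^sub>R (rpow t A * q t (s / t)) = exp (- s) *\<^sub>R ((1 / t) *\<^sub>R
          (rpow t A * (exp (- ((s / t\<^sup>2) *\<^sub>R Y)) * (rpow (s / t) (A - 1) * rpow (1 - s / t) (B - A - 1)))))"
        using t by (simp add: q_eq power2_eq_square)
      also have "rpow t A * (exp (- ((s / t\<^sup>2) *\<^sub>R Y)) * (rpow (s / t) (A - 1) * rpow (1 - s / t) (B - A - 1)))
        = (rpow t A * rpow (s / t) (A - 1)) * exp (- ((s / t\<^sup>2) *\<^sub>R Y)) * rpow (1 - s / t) (B - A - 1)"
        by (simp add: mult.assoc ac flip: scaleR_minus_left)
      also have "(1 / t) *\<^sub>R \<dots> = rpow s (A - 1) * exp (- ((s / t\<^sup>2) *\<^sub>R Y)) * rpow (1 - s / t) (B - A - 1)"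
        by (subst 1[symmetric]) simp
      finally show ?thesis using True t by (simp add: k_def e_def field_simps)
    next
      case False
      then have "s / t \<notin> {0<..<1/2}" using t by (auto simp: field_simps)
      then show ?thesis using False by (auto simp: k_def indicator_def)
    qed
    have "rpow t A * (LBINT u:{0<..<1/2}. q t u) = (\<integral>u. rpow t A * (indicator {0<..<1/2} u *\<^sub>R q t u) \<partial>lborel)"
      unfolding set_lebesgue_integral_def using int1[of t]
      by (subst Bochner_Integration.integral_mult_right) (auto simp: set_integrable_def)
    also have "\<dots> = \<bar>1 / t\<bar> *\<^sub>R (\<integral>s. rpow t A * (indicator {0<..<1/2} (0 + 1 / t * s) *\<^sub>R q t (0 + 1 / t * s)) \<partial>lborel)"
      using t by (intro lborel_integral_real_affine) auto
    also have "\<dots> = (\<integral>s. k t s \<partial>lborel)"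
      using t unfolding eq[symmetric] integral_scaleR_right by simp
    finally show ?thesis .
  qed
  have "((\<lambda>t. \<integral>s. k t s \<partial>lborel) \<longlongrightarrow> (\<integral>s. e s \<partial>lborel)) at_top"
  proof (rule integral_dominated_convergence_at_top[where w="\<lambda>s. norm (e s) * C * K"])
    show "integrable lborel (\<lambda>s. norm (e s) * C * K)" using int_e by simp
    have "((\<lambda>t. k t s) \<longlongrightarrow> e s) at_top" for s
    proof (cases "s > 0")
      case True
      have inv: "((\<lambda>t::real. 1 / t) \<longlongrightarrow> 0) at_top"
        by (rule tendsto_divide_0[OF tendsto_const filterlim_at_top_imp_at_infinity[OF filterlim_ident]])
      have "((\<lambda>t. e s * exp (- ((s * (1 / t)\<^sup>2) *\<^sub>R Y)) * rpow (1 - s * (1 / t)) (B - A - 1))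
          \<longlongrightarrow> e s * exp (- ((s * 0\<^sup>2) *\<^sub>R Y)) * 1) at_top"
        by (intro tendsto_mult tendsto_const tendsto_exp_algebra tendsto_minus tendsto_scaleR tendsto_power inv
            tendsto_rpow_1) (rule tendsto_eq_intros inv | simp)+
      then have "((\<lambda>t. e s * exp (- ((s / t\<^sup>2) *\<^sub>R Y)) * rpow (1 - s / t) (B - A - 1)) \<longlongrightarrow> e s) at_top"
        by (simp add: power_divide)
      \<comment> \<open>For fixed s the indicator in \<open>k t s\<close> is 1 as soon as t >
        2s.\<close>
      then show ?thesis
        by (rule Lim_transform_eventually)
          (use eventually_gt_at_top[of "2 * s"] in eventually_elim, use True in \<open>simp add: k_def\<close>)
    qed (simp add: k_def e_def)
    then show "AE s in lborel. ((\<lambda>t. k t s) \<longlongrightarrow> e s) at_top" by simp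
    have "norm (k t s) \<le> norm (e s) * C * K" if t: "t > 0" for t s
    proof (cases "0 < s \<and> s < t / 2")
      case True
      have "norm (e s * exp (- ((s / t\<^sup>2) *\<^sub>R Y)) * rpow (1 - s / t) (B - A - 1))
        \<le> norm (e s) * norm (exp (- ((s / t\<^sup>2) *\<^sub>R Y))) * norm (rpow (1 - s / t) (B - A - 1))"
        by (intro order_trans[OF norm_mult_ineq] mult_right_mono norm_mult_ineq) auto
      also have "\<dots> \<le> norm (e s) * C * K"
        using True t C K by (intro mult_mono C(2) K(2)) (auto simp: field_simps)
      finally show ?thesis using True by (simp add: k_def)
    next
      case False
      then show ?thesis using C K by (auto simp: k_def indicator_def)
    qed
    then show "\<forall>\<^sub>F t in at_top. AE s in lborel. norm (k t s) \<le> norm (e s) * C * K"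
      by (intro eventually_mono[OF eventually_gt_at_top[of 0]] AE_I2)
  qed (unfold k_def, measurable)
  then have "((\<lambda>t. rpow t A * (LBINT u:{0<..<1/2}. q t u)) \<longlongrightarrow> (\<integral>s. e s \<partial>lborel)) at_top"
    by (rule Lim_transform_eventually) (use eventually_gt_at_top[of 0] in eventually_elim, simp add: main)
  from tendsto_add[OF this tail] show ?thesis
    by (simp add: split distrib_left alg_Gamma_def set_lebesgue_integral_def e_def[abs_def])
qed

text \<open>Qv is nonzero, so P(t)v eventually has at least half its norm.\<close>

lemma eventually_norm_mult_vector_ge:
  fixes P :: "real \<Rightarrow> 'n::finite cmat"
  assumes "(P \<longlongrightarrow> Q) F" "invertible (mat_of Q)" "v \<noteq> 0"
  obtains \<delta> where "\<delta> > 0" "eventually (\<lambda>t. \<delta> \<le> norm (mat_of (P t) *v v)) F"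
proof -
  define n where "n = norm (mat_of Q *v v)"
  have "mat_of Q *v v \<noteq> 0"
  proof
    assume 0: "mat_of Q *v v = 0"
    obtain R where "R ** mat_of Q = mat 1" using assms(2) by (auto simp: invertible_def)
    then have "v = R *v (mat_of Q *v v)" by (simp add: matrix_vector_mul_assoc)
    with 0 assms(3) show False by simp
  qed
  then have n: "n > 0" by (simp add: n_def)
  have "((\<lambda>t. norm (mat_of (P t) *v v)) \<longlongrightarrow> n) F"
    unfolding n_def
    by (intro tendsto_norm bounded_linear.tendsto[OF bounded_linear_mat_of_mult] assms(1))
  then have "eventually (\<lambda>t. n / 2 < norm (mat_of (P t) *v v)) F"
    by (rule order_tendstoD(1)) (use n in simp)
  then have "eventually (\<lambda>t. n / 2 \<le> norm (mat_of (P t) *v v)) F"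
    by (rule eventually_mono) simp
  with n show ?thesis by (intro that[of "n / 2"]) auto
qed

lemma norm_mult_rpow_eigenvector:
  assumes "mat_of M *v v = c *s v" "t > 0"
  shows "norm (mat_of (P * rpow t (M - 1)) *v v) = t powr (Re c - 1) * norm (mat_of P *v v)"
proof -
  have "mat_of (P * rpow t (M - 1)) *v v = rpow t (c - 1) *s (mat_of P *v v)"
    by (simp add: rpow_eigenvector[OF minus_one_eigenvector[OF assms(1)]] matrix_vector_mult_smult
        flip: matrix_vector_mul_assoc)
  then show ?thesis using assms(2) by (simp add: norm_smult norm_rpow_complex)
qed


text \<open>Splitting t^(X-I) = t^A t^(X-A-I) isolates P(t), which converges to the invertible
  Gamma(A). On v the other factor is the scalar t^(-c-1), of modulus at least 1/t for t > 1.\<close>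

lemma kummer_integral_not_integrable:
  fixes A B X Y :: "'n::finite cmat"
  assumes A: "positive_stable (mat_of A)" and D: "exp_decaying (B - A)" and Y: "exp_decaying Y"
    and v: "mat_of (A - X) *v v = c *s v" "v \<noteq> 0" "Re c \<le> 0"
    and comm: "A * B = B * A" "A * X = X * A" "A * Y = Y * A" "B * X = X * B" "B * Y = Y * B" "X * Y = Y * X"
  shows "\<not> set_integrable lborel {0<..} (\<lambda>t. kummer_integral A B Y t * rpow t (X - 1))"
proof -
  have Adec: "exp_decaying A" using positive_stable_exp_decaying[OF A] by (simp add: cmat_simps)
  define P where "P t = rpow t A * kummer_integral A B Y t" for t
  have "(P \<longlongrightarrow> alg_Gamma A) at_top"
    unfolding P_def by (intro tendsto_rpow_kummer_integral Adec D Y comm)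
  moreover have "invertible (mat_of (alg_Gamma A))"
    using invertible_alg_Gamma[OF A] by (simp add: cmat_simps)
  ultimately obtain \<delta> where \<delta>: "\<delta> > 0" "eventually (\<lambda>t. \<delta> \<le> norm (mat_of (P t) *v v)) at_top"
    using v(2) by (rule eventually_norm_mult_vector_ge)
  from \<delta>(2) obtain T where T: "\<forall>t\<ge>T. \<delta> \<le> norm (mat_of (P t) *v v)"
    unfolding eventually_at_top_linorder by blast
  have eig: "mat_of (X - A) *v v = (- c) *s v"
  proof -
    have "mat_of (X - A) *v v = - (mat_of (A - X) *v v)"
      by (simp add: matrix_vector_mult_diff_rdistrib)
    then show ?thesis by (simp only: v(1)) (simp add: vec_eq_iff)
  qed
  have f_eq: "kummer_integral A B Y t * rpow t (X - 1) = P t * rpow t (X - A - 1)" for t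
  proof -
    define S where "S = {A, B, X, Y}"
    have S: "s * t = t * s" if "s \<in> S" "t \<in> S" for s t using that comm by (auto simp: S_def)
    have mem [simp]: "A \<in> bicommutant S" "B \<in> bicommutant S" "X \<in> bicommutant S" "Y \<in> bicommutant S"
      by (simp_all add: S_def bicommutant_superset)
    have J: "kummer_integral A B Y t \<in> bicommutant S"
      unfolding kummer_integral_def by (intro bicommutant_set_integral) (simp del: scaleR_minus_left)
    have "X - 1 = A + (X - A - 1)" by simp
    then have "rpow t (X - 1) = rpow t A * rpow t (X - A - 1)"
      using comm by (simp only:) (rule rpow_add, simp add: algebra_simps)
    moreover have "kummer_integral A B Y t * rpow t A = rpow t A * kummer_integral A B Y t"
      by (rule bicommutant_commute[OF S J bicommutant_rpow[OF mem(1)]])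
    ultimately show ?thesis by (simp add: P_def flip: mult.assoc)
  qed
  define n where "n = norm v"
  have "n > 0" using v(2) by (simp add: n_def)
  show ?thesis
  \<comment> \<open>Division by |v| passes from the vector to the operator norm; |T| + 1 lies beyond
    T and is at least 1.\<close>
  proof (rule not_set_integrable_lower_bound_at_top[of "\<delta> / n" "\<bar>T\<bar> + 1"])
    fix t :: real assume "t > \<bar>T\<bar> + 1"
    then have t: "t > 1" "\<delta> \<le> norm (mat_of (P t) *v v)" using T by auto
    have "\<delta> / t \<le> t powr (Re (- c) - 1) * norm (mat_of (P t) *v v)"
    proof -
      have "t powr - 1 \<le> t powr (Re (- c) - 1)" using t v(3) by (intro powr_mono) auto
      then have "1 / t \<le> t powr (Re (- c) - 1)" using t by (simp add: powr_minus_divide)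
      then have "1 / t * \<delta> \<le> t powr (Re (- c) - 1) * norm (mat_of (P t) *v v)"
        using t \<delta> by (intro mult_mono) auto
      then show ?thesis by simp
    qed
    also have "\<dots> = norm (mat_of (P t * rpow t (X - A - 1)) *v v)"
      using norm_mult_rpow_eigenvector[OF eig, of t "P t"] t by simp
    also have "\<dots> \<le> norm (P t * rpow t (X - A - 1)) * n"
      unfolding n_def by (rule norm_mat_of_mult_le)
    finally show "\<delta> / n / t \<le> norm (kummer_integral A B Y t * rpow t (X - 1))"
      using \<open>n > 0\<close> unfolding f_eq divide_divide_eq_left mult.commute[of n]
      unfolding divide_divide_eq_left[symmetric] by (subst pos_divide_le_eq)
  qed (use \<open>n > 0\<close> \<delta> in auto)
qed

text \<open>Moved to the right end, \<mu>^(A-X-I) meets v first and is the scalar \<mu>^(c-1), of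
  modulus at least 1/\<mu> for \<mu> < 1. What remains converges to the invertible Gamma(X).\<close>

lemma alg_Gamma_sub_not_integrable:
  fixes A B X Y :: "'n::finite cmat"
  assumes X: "positive_stable (mat_of X)" and Y: "exp_decaying Y"
    and v: "mat_of (A - X) *v v = c *s v" "v \<noteq> 0" "Re c \<le> 0"
    and comm: "A * B = B * A" "A * X = X * A" "B * X = X * B"
  shows "\<not> set_integrable lborel {0<..<1}
    (\<lambda>\<mu>. alg_Gamma_sub (\<mu>\<^sup>2 *\<^sub>R Y) X * rpow \<mu> (A - X - 1) * rpow (1 - \<mu>) (B - A - 1))"
proof -
  have Xdec: "exp_decaying X" using positive_stable_exp_decaying[OF X] by (simp add: cmat_simps)
  define P where "P u = alg_Gamma_sub (u\<^sup>2 *\<^sub>R Y) X * rpow (1 - u) (B - A - 1)" for u :: real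
  have "((\<lambda>t::real. 1 - 1 / t) \<longlongrightarrow> 1 - 0) at_top"
    by (intro tendsto_diff tendsto_const tendsto_divide_0[OF tendsto_const]
        filterlim_at_top_imp_at_infinity filterlim_ident)
  then have "((\<lambda>t. P (1 / t)) \<longlongrightarrow> alg_Gamma X * 1) at_top"
    unfolding P_def by (intro tendsto_mult tendsto_alg_Gamma_sub tendsto_rpow_1 Xdec Y) simp
  then have "((\<lambda>t. P (1 / t)) \<longlongrightarrow> alg_Gamma X) at_top" by simp
  moreover have "invertible (mat_of (alg_Gamma X))"
    using invertible_alg_Gamma[OF X] by (simp add: cmat_simps)
  ultimately obtain \<delta> where \<delta>: "\<delta> > 0" "eventually (\<lambda>t. \<delta> \<le> norm (mat_of (P (1 / t)) *v v)) at_top"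
    using v(2) by (rule eventually_norm_mult_vector_ge)
  from \<delta>(2) obtain T where T: "\<forall>t\<ge>T. \<delta> \<le> norm (mat_of (P (1 / t)) *v v)"
    unfolding eventually_at_top_linorder by blast
  have g_eq: "alg_Gamma_sub (u\<^sup>2 *\<^sub>R Y) X * rpow u (A - X - 1) * rpow (1 - u) (B - A - 1) = P u * rpow u (A - X - 1)" for u
  proof -
    have "rpow u (A - X - 1) * rpow (1 - u) (B - A - 1) = rpow (1 - u) (B - A - 1) * rpow u (A - X - 1)"
      by (rule bicommutant_commute[of "{A, B, X}"]) (auto simp: comm bicommutant_superset)
    then show ?thesis by (simp add: P_def mult.assoc)
  qed
  define n where "n = norm v"
  have "n > 0" using v(2) by (simp add: n_def)
  show ?thesis
  \<comment> \<open>The limit was taken in t = 1/u; u below 1/(|T| + 1) gives t \<ge> T and u <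
    1.\<close>
  proof (rule not_set_integrable_lower_bound_at_0[of "\<delta> / n" "1 / (\<bar>T\<bar> + 1)"])
    fix u :: real assume u: "0 < u" "u < 1 / (\<bar>T\<bar> + 1)"
    have "\<bar>T\<bar> + 1 < 1 / u" using u by (simp add: field_simps)
    then have "1 / u \<ge> T" by simp
    with T have "\<delta> \<le> norm (mat_of (P (1 / (1 / u))) *v v)" by blast
    then have P: "\<delta> \<le> norm (mat_of (P u) *v v)" by simp
    have "u < 1" using u(2) by (rule less_le_trans) simp
    have "\<delta> / u \<le> u powr (Re c - 1) * norm (mat_of (P u) *v v)"
    proof -
      have "u powr - 1 \<le> u powr (Re c - 1)" using u \<open>u < 1\<close> v(3) by (intro powr_mono') auto
      then have "1 / u \<le> u powr (Re c - 1)" using u by (simp add: powr_minus_divide)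
      then have "1 / u * \<delta> \<le> u powr (Re c - 1) * norm (mat_of (P u) *v v)"
        using P \<delta> by (intro mult_mono) auto
      then show ?thesis by simp
    qed
    also have "\<dots> = norm (mat_of (P u * rpow u (A - X - 1)) *v v)"
      using norm_mult_rpow_eigenvector[OF v(1) u(1), of "P u"] by simp
    also have "\<dots> \<le> norm (P u * rpow u (A - X - 1)) * n"
      unfolding n_def by (rule norm_mat_of_mult_le)
    finally show "\<delta> / n / u \<le> norm (alg_Gamma_sub (u\<^sup>2 *\<^sub>R Y) X * rpow u (A - X - 1) * rpow (1 - u) (B - A - 1))"
      using \<open>n > 0\<close> unfolding g_eq divide_divide_eq_left mult.commute[of n]
      unfolding divide_divide_eq_left[symmetric] by (subst pos_divide_le_eq)
  qed (use \<open>n > 0\<close> \<delta> in auto)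
qed

section \<open>Translation back to the matrices and conclusion\<close>

lemma mat_powr_eq: "mat_powr t M = mat_of (rpow t (cmat M))"
  by (simp add: mat_powr_def mat_exp_eq rpow_def cmat_simps)

text \<open>Both \<open>mat_of\<close> and its inverse are bounded, so integrability is the same on
  both sides, and a divergent integral gives the default 0 on both.\<close>

lemma set_integral_mat_of:
  fixes f :: "real \<Rightarrow> 'n::finite cmat"
  shows "(LBINT t:S. mat_of (f t)) = mat_of (LBINT t:S. f t)"
    and "set_integrable lborel S (\<lambda>t. mat_of (f t)) \<longleftrightarrow> set_integrable lborel S f"
proof -
  show iff: "set_integrable lborel S (\<lambda>t. mat_of (f t)) \<longleftrightarrow> set_integrable lborel S f"
  proof
    assume "set_integrable lborel S (\<lambda>t. mat_of (f t))"
    from integrable_bounded_linear[OF bounded_linear_cmat this[unfolded set_integrable_def]]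
    show "set_integrable lborel S f" by (simp add: set_integrable_def cmat_simps)
  next
    assume "set_integrable lborel S f"
    from integrable_bounded_linear[OF bounded_linear_mat_of this[unfolded set_integrable_def]]
    show "set_integrable lborel S (\<lambda>t. mat_of (f t))" by (simp add: set_integrable_def)
  qed
  show "(LBINT t:S. mat_of (f t)) = mat_of (LBINT t:S. f t)"
  proof (cases "set_integrable lborel S f")
    case True
    from integral_bounded_linear[OF bounded_linear_mat_of this[unfolded set_integrable_def]]
    show ?thesis by (simp add: set_lebesgue_integral_def)
  next
    case False
    then show ?thesis
      using iff by (simp add: set_lebesgue_integral_def set_integrable_def not_integrable_integral_eq)
  qed
qed

lemma mat_Gamma_eq: "mat_Gamma M = mat_of (alg_Gamma (cmat M))"
  unfolding mat_Gamma_def alg_Gamma_def set_integral_mat_of(1)[symmetric]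
  by (simp add: mat_powr_eq cmat_simps)

lemma mat_Gamma_sub_eq: "mat_Gamma_sub Y X = mat_of (alg_Gamma_sub (cmat Y) (cmat X))"
  unfolding mat_Gamma_sub_def alg_Gamma_sub_def set_integral_mat_of(1)[symmetric]
  by (simp add: mat_powr_eq mat_exp_eq cmat_simps)

theorem theorem3p1:
  fixes A B X Y :: "complex^'n^'n"
  assumes "positive_stable A" and "positive_stable B" and "positive_stable (B - A)"
    and "positive_stable X" and "positive_stable Y"
    and "commuting A B" and "commuting A X" and "commuting A Y"
    and "commuting B X" and "commuting B Y" and "commuting X Y"
  shows "(set_integrable lborel {0<..} (ext_Gamma_integrand A B Y X) \<longleftrightarrow>
          set_integrable lborel {0<..<1}
            (\<lambda>\<mu>. mat_Gamma_sub (\<mu>\<^sup>2 *\<^sub>R Y) X ** mat_powr \<mu> (A - X - mat 1)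
                  ** mat_powr (1 - \<mu>) (B - A - mat 1)))
       \<and> ext_Gamma A B Y X =
           mat_Gamma B ** matrix_inv (mat_Gamma A) ** matrix_inv (mat_Gamma (B - A)) **
           (LBINT \<mu>:{0<..<1}. mat_Gamma_sub (\<mu>\<^sup>2 *\<^sub>R Y) X ** mat_powr \<mu> (A - X - mat 1)
                                ** mat_powr (1 - \<mu>) (B - A - mat 1))"
proof -
  define a b x y where defs: "a = cmat A" "b = cmat B" "x = cmat X" "y = cmat Y"
  have dec: "exp_decaying a" "exp_decaying b" "exp_decaying (b - a)" "exp_decaying x" "exp_decaying y"
    using assms(1-5)[THEN positive_stable_exp_decaying] by (simp_all add: defs cmat_simps)
  have comm: "a * b = b * a" "a * x = x * a" "a * y = y * a" "b * x = x * b" "b * y = y * b" "x * y = y * x"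
    using assms(6-11) by (simp_all add: defs commuting_def flip: cmat_simps)
  define K where "K = hyp_const a b"
  define f where "f t = kummer_integral a b y t * rpow t (x - 1)" for t
  define g where "g \<mu> = alg_Gamma_sub (\<mu>\<^sup>2 *\<^sub>R y) x * rpow \<mu> (a - x - 1) * rpow (1 - \<mu>) (b - a - 1)" for \<mu>
  have integrand: "ext_Gamma_integrand A B Y X t = mat_of (K * f t)" for t
  proof -
    define W where "W = - t *\<^sub>R 1 - (1 / t) *\<^sub>R y"
    have "a * W = W * a" "b * W = W * b"
      using comm by (simp_all add: W_def algebra_simps)
    then have "mat_1F1 (mat_of a) (mat_of b) (mat_of W) = mat_of (K * kummer_integral a b y t)"
      unfolding K_def kummer_integral_def W_def[symmetric]
      using assms comm(1) by (intro mat_1F1_eq_integral) (simp_all add: defs)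
    then have "mat_1F1 A B (- t *\<^sub>R mat 1 - (1 / t) *\<^sub>R Y) = mat_of (K * kummer_integral a b y t)"
      by (simp add: W_def defs)
    then show ?thesis
      by (simp add: ext_Gamma_integrand_def mat_powr_eq f_def defs cmat_simps matrix_mul_assoc)
  qed
  have rhs: "mat_Gamma_sub (\<mu>\<^sup>2 *\<^sub>R Y) X ** mat_powr \<mu> (A - X - mat 1) ** mat_powr (1 - \<mu>) (B - A - mat 1)
      = mat_of (g \<mu>)" for \<mu>
    by (simp add: g_def mat_Gamma_sub_eq mat_powr_eq defs cmat_simps)
  have const: "mat_Gamma B ** matrix_inv (mat_Gamma A) ** matrix_inv (mat_Gamma (B - A)) = mat_of K"
    by (simp add: K_def hyp_const_def mat_Gamma_eq cinv_def defs cmat_simps)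
  have integrals: "(set_integrable lborel {0<..} f \<longleftrightarrow> set_integrable lborel {0<..<1} g) \<and>
      (LBINT t:{0<..}. f t) = (LBINT \<mu>:{0<..<1}. g \<mu>)"
  proof (cases "positive_stable (A - X)")
    case True
    then have "exp_decaying (a - x)" using positive_stable_exp_decaying by (simp add: defs flip: cmat_simps)
    from Fubini_kummer_Gamma_sub[OF dec(3,1,4,5) this comm]
    show ?thesis unfolding f_def g_def by simp
  next
    case False
    then obtain c v where v: "v \<noteq> 0" "(A - X) *v v = c *s v" "Re c \<le> 0"
      by (auto simp: positive_stable_def eigenvalue_def not_less)
    have v': "mat_of (a - x) *v v = c *s v" using v(2) by (simp add: defs)
    have "\<not> set_integrable lborel {0<..} f"
      unfolding f_def using assms(1)
      by (intro kummer_integral_not_integrable[OF _ dec(3,5) v' v(1,3) comm]) (simp add: defs)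
    moreover have "\<not> set_integrable lborel {0<..<1} g"
      unfolding g_def using assms(4)
      by (intro alg_Gamma_sub_not_integrable[OF _ dec(5) v' v(1,3) comm(1,2,4)]) (simp add: defs)
    ultimately show ?thesis
      by (simp add: set_integrable_def set_lebesgue_integral_def not_integrable_integral_eq)
  qed
  \<comment> \<open>A left inverse of K; multiplication by it recovers the integrability of f from
    that of \<open>K * f t\<close>.\<close>
  define L where "L = alg_Gamma (b - a) * alg_Gamma a * cinv (alg_Gamma b)"
  have LK: "L * K = 1"
  proof -
    have inv: "invertible (mat_of (alg_Gamma a))" "invertible (mat_of (alg_Gamma b))"
      "invertible (mat_of (alg_Gamma (b - a)))"
      using assms(1-3)[THEN invertible_alg_Gamma] by (simp_all add: defs cmat_simps)
    have "L * K = alg_Gamma (b - a) * (alg_Gamma a * (cinv (alg_Gamma b) * alg_Gamma b) *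
        cinv (alg_Gamma a)) * cinv (alg_Gamma (b - a))"
      by (simp only: L_def K_def hyp_const_def mult.assoc)
    then show ?thesis by (simp add: cinv_mult inv)
  qed
  have intK: "set_integrable lborel {0<..} (\<lambda>t. K * f t) \<longleftrightarrow> set_integrable lborel {0<..} f"
  proof
    assume "set_integrable lborel {0<..} (\<lambda>t. K * f t)"
    then have "integrable lborel (\<lambda>t. L * (indicator {0<..} t *\<^sub>R (K * f t)))"
      unfolding set_integrable_def by (rule integrable_mult_right)
    moreover have "L * (K * f t) = f t" for t by (simp add: LK flip: mult.assoc)
    ultimately show "set_integrable lborel {0<..} f" by (simp add: set_integrable_def)
  next
    assume "set_integrable lborel {0<..} f"
    then have "integrable lborel (\<lambda>t. K * (indicator {0<..} t *\<^sub>R f t))"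
      unfolding set_integrable_def by (rule integrable_mult_right)
    then show "set_integrable lborel {0<..} (\<lambda>t. K * f t)" by (simp add: set_integrable_def)
  qed
  \<comment> \<open>K leaves the integral even when f is not integrable: by \<open>intK\<close> both
    integrals are then the default 0.\<close>
  have intK_eq: "(LBINT t:{0<..}. K * f t) = K * (LBINT t:{0<..}. f t)"
  proof (cases "set_integrable lborel {0<..} f")
    case True
    then have "(\<integral>t. K * (indicator {0<..} t *\<^sub>R f t) \<partial>lborel) = K * (\<integral>t. indicator {0<..} t *\<^sub>R f t \<partial>lborel)"
      unfolding set_integrable_def by (rule Bochner_Integration.integral_mult_right)
    then show ?thesis by (simp add: set_lebesgue_integral_def)
  next
    case False
    with intK show ?thesis
      by (simp add: set_integrable_def set_lebesgue_integral_def not_integrable_integral_eq)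
  qed
  show ?thesis
    unfolding ext_Gamma_def rhs const integrand[abs_def] set_integral_mat_of intK intK_eq
    using integrals by simp
qed

end
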